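(* Let $\mathcal{V}$ be any non-distributive variety of lattices and let $F$ be any free (resp., free bounded) lattice with at least $\aleph_2$ generators in $\mathcal{V}$. Then there exists no V-distance of type $3/2$ with range join-generating $\mathrm{Con_c}\,F$. In particular, there is no algebra $A$ with almost permutable congruences such that $\mathrm{Con}\,F\cong\mathrm{Con}\,A$.
   Context: For an algebra $A$, $\mathrm{Con}\,A$ denotes the lattice of all congruences of $A$ and $\mathrm{Con_c}\,A$ the $\langle\vee,0\rangle$-semilattice of all compact (i.e., finitely generated) congruences of $A$. An algebra $A$ has almost permutable congruences if $\alpha\vee\beta=\alpha\beta\cup\beta\alpha$ for all congruences $\alpha,\beta$ of $A$, where $\alpha\beta$ denotes composition of relations. A variety of lattices is non-distributive if it contains a non-distributive lattice. Let $S$ be a $\langle\vee,0\rangle$-semilattice and $X$ a set. A map $\delta\colon X\times X\to S$ is an $S$-valued distance on $X$ if $\delta(x,x)=0$, $\delta(x,y)=\delta(y,x)$, and $\delta(x,z)\leq\delta(x,y)\vee\delta(y,z)$ for all $x,y,z\in X$. An $S$-valued distance $\delta$ on $X$ is a V-distance of type $3/2$ if for all $x,y\in X$ and all $a,b\in S$ such that $\delta(x,y)\leq a\vee b$, there exists $z\in X$ such that either ($\delta(x,z)\leq a$ and $\delta(z,y)\leq b$) or ($\delta(x,z)\leq b$ and $\delta(z,y)\leq a$). The range of $\delta$ join-generates $S$ if every element of $S$ is a finite join of elements of the range of $\delta$. *)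

theory Defs
  imports "HOL-Algebra.Lattice" "HOL-Library.FuncSet"
begin

section \<open>Algebras and their congruences\<close>

text \<open>An algebra is a set with a family of finitary operations, here given as pairs of an arity
  and a function on argument lists. The indexing of the operations plays no role for congruences,
  so the family is represented by the set of its members.\<close>

record 'a univ_alg = "'a partial_object" +
  ops :: "(nat \<times> ('a list \<Rightarrow> 'a)) set"

definition algebra :: "('a, 'm) univ_alg_scheme \<Rightarrow> bool" where
  "algebra A \<longleftrightarrow>
     (\<forall>(n, f) \<in> ops A. \<forall>xs. length xs = n \<and> set xs \<subseteq> carrier A \<longrightarrow> f xs \<in> carrier A)"

definition congruence :: "('a, 'm) univ_alg_scheme \<Rightarrow> ('a \<times> 'a) set \<Rightarrow> bool" where
  "congruence A \<theta> \<longleftrightarrow> equiv (carrier A) \<theta> \<and>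
     (\<forall>(n, f) \<in> ops A. \<forall>xs ys. length xs = n \<and> list_all2 (\<lambda>x y. (x, y) \<in> \<theta>) xs ys
        \<longrightarrow> (f xs, f ys) \<in> \<theta>)"

definition Cg :: "('a, 'm) univ_alg_scheme \<Rightarrow> ('a \<times> 'a) set \<Rightarrow> ('a \<times> 'a) set" where
  "Cg A R = \<Inter>{\<theta>. congruence A \<theta> \<and> R \<subseteq> \<theta>}"

definition Con :: "('a, 'm) univ_alg_scheme \<Rightarrow> ('a \<times> 'a) set gorder" where
  "Con A = \<lparr>carrier = {\<theta>. congruence A \<theta>}, eq = (=), le = (\<subseteq>)\<rparr>"

definition Conc :: "('a, 'm) univ_alg_scheme \<Rightarrow> ('a \<times> 'a) set gorder" where
  "Conc A = \<lparr>carrier = {Cg A R | R. finite R \<and> R \<subseteq> carrier A \<times> carrier A}, eq = (=), le = (\<subseteq>)\<rparr>"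

definition almost_permutable_congruences :: "('a, 'm) univ_alg_scheme \<Rightarrow> bool" where
  "almost_permutable_congruences A \<longleftrightarrow>
     (\<forall>\<alpha> \<in> carrier (Con A). \<forall>\<beta> \<in> carrier (Con A). \<alpha> \<squnion>\<^bsub>Con A\<^esub> \<beta> = (\<alpha> O \<beta>) \<union> (\<beta> O \<alpha>))"

text \<open>For lattices, order isomorphisms and lattice isomorphisms coincide.\<close>

definition order_isomorphic :: "('a, 'm) gorder_scheme \<Rightarrow> ('b, 'n) gorder_scheme \<Rightarrow> bool" where
  "order_isomorphic L M \<longleftrightarrow> (\<exists>\<phi>. bij_betw \<phi> (carrier L) (carrier M) \<and> order_emb L M \<phi>)"


section \<open>Distances valued in a join-semilattice with zero\<close>

text \<open>Below, \<open>S\<close> is meant to be a partially ordered set with binary joins and a least element.\<close>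

definition S_valued_distance :: "('s, 'm) gorder_scheme \<Rightarrow> 'x set \<Rightarrow> ('x \<Rightarrow> 'x \<Rightarrow> 's) \<Rightarrow> bool" where
  "S_valued_distance S X \<delta> \<longleftrightarrow>
     (\<forall>x \<in> X. \<forall>y \<in> X. \<delta> x y \<in> carrier S) \<and>
     (\<forall>x \<in> X. \<delta> x x = \<bottom>\<^bsub>S\<^esub>) \<and>
     (\<forall>x \<in> X. \<forall>y \<in> X. \<delta> x y = \<delta> y x) \<and>
     (\<forall>x \<in> X. \<forall>y \<in> X. \<forall>z \<in> X. \<delta> x z \<sqsubseteq>\<^bsub>S\<^esub> \<delta> x y \<squnion>\<^bsub>S\<^esub> \<delta> y z)"

definition V_distance_three_halves ::
    "('s, 'm) gorder_scheme \<Rightarrow> 'x set \<Rightarrow> ('x \<Rightarrow> 'x \<Rightarrow> 's) \<Rightarrow> bool" where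
  "V_distance_three_halves S X \<delta> \<longleftrightarrow> S_valued_distance S X \<delta> \<and>
     (\<forall>x \<in> X. \<forall>y \<in> X. \<forall>a \<in> carrier S. \<forall>b \<in> carrier S. \<delta> x y \<sqsubseteq>\<^bsub>S\<^esub> a \<squnion>\<^bsub>S\<^esub> b \<longrightarrow>
        (\<exists>z \<in> X. (\<delta> x z \<sqsubseteq>\<^bsub>S\<^esub> a \<and> \<delta> z y \<sqsubseteq>\<^bsub>S\<^esub> b) \<or> (\<delta> x z \<sqsubseteq>\<^bsub>S\<^esub> b \<and> \<delta> z y \<sqsubseteq>\<^bsub>S\<^esub> a)))"

text \<open>The empty join is the zero element.\<close>

definition range_join_generates ::
    "('s, 'm) gorder_scheme \<Rightarrow> 'x set \<Rightarrow> ('x \<Rightarrow> 'x \<Rightarrow> 's) \<Rightarrow> bool" where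
  "range_join_generates S X \<delta> \<longleftrightarrow>
     (\<forall>s \<in> carrier S. \<exists>D. finite D \<and> D \<subseteq> {\<delta> x y | x y. x \<in> X \<and> y \<in> X} \<and> s = \<Squnion>\<^bsub>S\<^esub>D)"


section \<open>Varieties of lattices and their free members\<close>

text \<open>A variety of lattices is the class of all lattices satisfying a given set \<open>E\<close> of lattice
  identities, an identity being a pair of lattice terms.\<close>

datatype lat_term = Var nat | Join lat_term lat_term | Meet lat_term lat_term

primrec lat_eval :: "('a, 'm) gorder_scheme \<Rightarrow> (nat \<Rightarrow> 'a) \<Rightarrow> lat_term \<Rightarrow> 'a" where
  "lat_eval L v (Var i) = v i"
| "lat_eval L v (Join s t) = lat_eval L v s \<squnion>\<^bsub>L\<^esub> lat_eval L v t"
| "lat_eval L v (Meet s t) = lat_eval L v s \<sqinter>\<^bsub>L\<^esub> lat_eval L v t"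

definition in_variety :: "(lat_term \<times> lat_term) set \<Rightarrow> ('a, 'm) gorder_scheme \<Rightarrow> bool" where
  "in_variety E L \<longleftrightarrow> lattice L \<and>
     (\<forall>(s, t) \<in> E. \<forall>v \<in> UNIV \<rightarrow> carrier L. lat_eval L v s = lat_eval L v t)"

definition distributive :: "('a, 'm) gorder_scheme \<Rightarrow> bool" where
  "distributive L \<longleftrightarrow> (\<forall>x \<in> carrier L. \<forall>y \<in> carrier L. \<forall>z \<in> carrier L.
     x \<sqinter>\<^bsub>L\<^esub> (y \<squnion>\<^bsub>L\<^esub> z) = (x \<sqinter>\<^bsub>L\<^esub> y) \<squnion>\<^bsub>L\<^esub> (x \<sqinter>\<^bsub>L\<^esub> z))"

definition lattice_hom :: "('a, 'm) gorder_scheme \<Rightarrow> ('b, 'n) gorder_scheme \<Rightarrow> ('a \<Rightarrow> 'b) \<Rightarrow> bool" where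
  "lattice_hom L M h \<longleftrightarrow> h \<in> carrier L \<rightarrow> carrier M \<and> join_pres L M h \<and> meet_pres L M h"

definition bounded_lattice_hom ::
    "('a, 'm) gorder_scheme \<Rightarrow> ('b, 'n) gorder_scheme \<Rightarrow> ('a \<Rightarrow> 'b) \<Rightarrow> bool" where
  "bounded_lattice_hom L M h \<longleftrightarrow> lattice_hom L M h \<and> h \<bottom>\<^bsub>L\<^esub> = \<bottom>\<^bsub>M\<^esub> \<and> h \<top>\<^bsub>L\<^esub> = \<top>\<^bsub>M\<^esub>"

text \<open>\<open>free_lattice E F G\<close>: the lattice \<open>F\<close> is free on \<open>G\<close> in the variety given by \<open>E\<close>. HOL cannot
  quantify over all types inside a formula, so the test lattices \<open>L\<close> of the universal property are
  those whose carrier is an arbitrary subset of the element type of \<open>F\<close>. The full universal property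
  implies this one. For infinite \<open>G\<close> the converse holds as well: a map from \<open>G\<close> to any lattice
  generates a sublattice of at most \<open>|G|\<close> elements, which has an isomorphic copy inside that type.
  For finite \<open>G\<close> the converse can fail, so these definitions are only to be used for infinite \<open>G\<close>.\<close>

definition free_lattice :: "(lat_term \<times> lat_term) set \<Rightarrow> 'f gorder \<Rightarrow> 'f set \<Rightarrow> bool" where
  "free_lattice E F G \<longleftrightarrow> in_variety E F \<and> G \<subseteq> carrier F \<and>
     (\<forall>L :: 'f gorder. in_variety E L \<longrightarrow> (\<forall>g \<in> G \<rightarrow> carrier L.
        \<exists>!h. h \<in> extensional (carrier F) \<and> lattice_hom F L h \<and> (\<forall>x \<in> G. h x = g x)))"

definition free_bounded_lattice :: "(lat_term \<times> lat_term) set \<Rightarrow> 'f gorder \<Rightarrow> 'f set \<Rightarrow> bool" where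
  "free_bounded_lattice E F G \<longleftrightarrow> in_variety E F \<and> bounded_lattice F \<and> G \<subseteq> carrier F \<and>
     (\<forall>L :: 'f gorder. in_variety E L \<and> bounded_lattice L \<longrightarrow> (\<forall>g \<in> G \<rightarrow> carrier L.
        \<exists>!h. h \<in> extensional (carrier F) \<and> bounded_lattice_hom F L h \<and> (\<forall>x \<in> G. h x = g x)))"

text \<open>A lattice as an algebra. The bounds of a bounded lattice need not be included: constants do
  not affect congruences.\<close>

definition lattice_alg :: "('a, 'm) gorder_scheme \<Rightarrow> 'a univ_alg" where
  "lattice_alg L = \<lparr>carrier = carrier L,
     ops = {(2, \<lambda>xs. xs ! 0 \<squnion>\<^bsub>L\<^esub> xs ! 1), (2, \<lambda>xs. xs ! 0 \<sqinter>\<^bsub>L\<^esub> xs ! 1)}\<rparr>"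


section \<open>The compact congruences form a join-semilattice with zero\<close>

lemma congruence_Cg:
  assumes A: "algebra A" and R: "R \<subseteq> carrier A \<times> carrier A"
  shows "congruence A (Cg A R)"
proof -
  let ?T = "{\<theta>. congruence A \<theta> \<and> R \<subseteq> \<theta>}"
  have full: "carrier A \<times> carrier A \<in> ?T"
  proof -
    have eq: "equiv (carrier A) (carrier A \<times> carrier A)"
      by (rule equivI) (auto simp: refl_on_def sym_def trans_def)
    have "(f xs, f ys) \<in> carrier A \<times> carrier A"
      if f: "(n, f) \<in> ops A" and len: "length xs = n"
        and rel: "list_all2 (\<lambda>x y. (x, y) \<in> carrier A \<times> carrier A) xs ys" for n f xs ys
    proof -
      have "set xs \<subseteq> carrier A" "set ys \<subseteq> carrier A" "length ys = n"
        using rel len by (auto simp: list_all2_conv_all_nth in_set_conv_nth)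
      then show ?thesis using A f len unfolding algebra_def by blast
    qed
    then show ?thesis using eq R unfolding congruence_def by blast
  qed
  have "equiv (carrier A) (\<Inter>?T)"
  proof (rule equivI)
    show "\<Inter>?T \<subseteq> carrier A \<times> carrier A" using full by blast
    show "refl_on (carrier A) (\<Inter>?T)" by (auto simp: congruence_def equiv_def refl_on_def)
    show "sym (\<Inter>?T)" by (auto simp: congruence_def equiv_def sym_def)
    show "trans (\<Inter>?T)" unfolding trans_def congruence_def equiv_def by blast
  qed
  moreover have "(f xs, f ys) \<in> \<Inter>?T"
    if f: "(n, f) \<in> ops A" "length xs = n" "list_all2 (\<lambda>x y. (x, y) \<in> \<Inter>?T) xs ys" for n f xs ys
  proof
    fix \<theta> assume \<theta>: "\<theta> \<in> ?T"
    then have "list_all2 (\<lambda>x y. (x, y) \<in> \<theta>) xs ys"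
      using f(3) by (auto elim!: list_all2_mono)
    then show "(f xs, f ys) \<in> \<theta>" using \<theta> f by (auto simp: congruence_def)
  qed
  ultimately show ?thesis unfolding congruence_def Cg_def by blast
qed

lemma Cg_le_iff:
  assumes "algebra A" "R \<subseteq> carrier A \<times> carrier A" "congruence A \<theta>"
  shows "Cg A R \<subseteq> \<theta> \<longleftrightarrow> R \<subseteq> \<theta>"
  using assms by (auto simp: Cg_def)

lemma Conc_zero:
  assumes "algebra A"
  shows "least (Conc A) (Cg A {}) (carrier (Conc A))"
  using congruence_Cg[OF assms] Cg_le_iff[OF assms, of "{}"]
  by (auto simp: least_def Conc_def)

lemma Conc_join:
  assumes A: "algebra A"
    and P: "finite P" "P \<subseteq> carrier A \<times> carrier A" and Q: "finite Q" "Q \<subseteq> carrier A \<times> carrier A"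
  shows "least (Conc A) (Cg A (P \<union> Q)) (Upper (Conc A) {Cg A P, Cg A Q})"
proof -
  have PQ: "P \<union> Q \<subseteq> carrier A \<times> carrier A" using P Q by blast
  have up: "P \<subseteq> Cg A P" "Q \<subseteq> Cg A Q" "P \<union> Q \<subseteq> Cg A (P \<union> Q)" by (auto simp: Cg_def)
  have 1: "Cg A P \<subseteq> Cg A (P \<union> Q)" "Cg A Q \<subseteq> Cg A (P \<union> Q)" by (auto simp: Cg_def)
  have mem: "Cg A P \<in> carrier (Conc A)" "Cg A Q \<in> carrier (Conc A)"
    "Cg A (P \<union> Q) \<in> carrier (Conc A)"
  proof -
    have "Cg A R \<in> carrier (Conc A)" if "finite R" "R \<subseteq> carrier A \<times> carrier A" for R
      using that unfolding Conc_def by auto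
    then show "Cg A P \<in> carrier (Conc A)" "Cg A Q \<in> carrier (Conc A)"
      "Cg A (P \<union> Q) \<in> carrier (Conc A)"
      using P Q PQ by blast+
  qed
  have "Cg A (P \<union> Q) \<subseteq> \<theta>" if "\<theta> \<in> Upper (Conc A) {Cg A P, Cg A Q}" for \<theta>
  proof -
    have "congruence A \<theta>" "Cg A P \<subseteq> \<theta>" "Cg A Q \<subseteq> \<theta>"
      using that mem congruence_Cg[OF A] unfolding Upper_def Conc_def by auto
    then show ?thesis using Cg_le_iff[OF A PQ] up by blast
  qed
  moreover have "Cg A (P \<union> Q) \<in> Upper (Conc A) {Cg A P, Cg A Q}"
  proof -
    have "x \<sqsubseteq>\<^bsub>Conc A\<^esub> Cg A (P \<union> Q)" if "x \<in> {Cg A P, Cg A Q}" for x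
      using that 1 unfolding Conc_def by auto
    then show ?thesis using mem(3) unfolding Upper_def by blast
  qed
  moreover have "Upper (Conc A) {Cg A P, Cg A Q} \<subseteq> carrier (Conc A)"
    by (simp add: Upper_def)
  ultimately show ?thesis unfolding least_def by (simp add: Conc_def)
qed

lemma Conc_semilattice:
  assumes A: "algebra A"
  shows "upper_semilattice (Conc A)" "weak_partial_order_bottom (Conc A)"
proof -
  have po: "partial_order (Conc A)"
    by unfold_locales (auto simp: Conc_def)
  interpret partial_order "Conc A" by (rule po)
  show "upper_semilattice (Conc A)"
  proof unfold_locales
    fix x y assume "x \<in> carrier (Conc A)" "y \<in> carrier (Conc A)"
    then obtain P Q where "finite P" "P \<subseteq> carrier A \<times> carrier A" "x = Cg A P"
      "finite Q" "Q \<subseteq> carrier A \<times> carrier A" "y = Cg A Q"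
      by (auto simp: Conc_def)
    then show "\<exists>s. least (Conc A) s (Upper (Conc A) {x, y})" using Conc_join[OF A] by blast
  qed
  show "weak_partial_order_bottom (Conc A)"
    by unfold_locales (use Conc_zero[OF A] in blast)
qed

lemma algebra_lattice_alg:
  assumes "lattice L"
  shows "algebra (lattice_alg L)"
proof -
  interpret lattice L by (rule assms)
  have "xs ! 0 \<in> carrier L" "xs ! 1 \<in> carrier L"
    if "length xs = 2" "set xs \<subseteq> carrier L" for xs
    using that nth_mem[of 0 xs] nth_mem[of 1 xs] by auto
  then show ?thesis by (auto simp: algebra_def lattice_alg_def)
qed

end

theory Submission
  imports Defs "HOL-Library.Countable_Set_Type"
begin

text \<open>A V-distance of type \<open>3/2\<close> forces a uniform refinement property on its range semilattice \<open>S\<close>.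
  Suppose \<open>e \<le> a\<^sub>i \<squnion> b\<^sub>i\<close> for all \<open>i\<close> in an index set of size at least \<open>\<aleph>\<^sub>2\<close>. As \<open>e\<close> is a finite join of
  distances \<open>\<delta> p q\<close>, each index \<open>i\<close> picks for each of these a point \<open>z\<^sub>i\<close> between \<open>p\<close> and \<open>q\<close>, together
  with one of the two orders in which \<open>a\<^sub>i\<close> and \<open>b\<^sub>i\<close> occur on the way. There are only finitely many
  patterns of orders, so \<open>\<aleph>\<^sub>2\<close> indices share one pattern, and on these the joins \<open>c\<^sub>i\<^sub>j\<close> of the distances
  between the points of \<open>i\<close> and those of \<open>j\<close> lie below \<open>a\<^sub>i \<squnion> a\<^sub>j\<close> and below \<open>b\<^sub>i \<squnion> b\<^sub>j\<close>, satisfy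
  \<open>e \<le> a\<^sub>j \<squnion> b\<^sub>i \<squnion> c\<^sub>i\<^sub>j\<close>, and obey the triangle inequality (\<open>uniform_refinement\<close>).

  In the free lattice \<open>F\<close> the compact congruences violate this. Let two fixed generators span an
  interval \<open>[0, 1]\<close> and let each index \<open>i\<close> own two further generators, from which elements
  \<open>0 \<le> s\<^sub>i \<le> t\<^sub>i \<le> 1\<close> are built. Take \<open>e = \<Theta>(0, 1)\<close>, \<open>a\<^sub>i = \<Theta>(0, s\<^sub>i) \<squnion> \<Theta>(t\<^sub>i, 1)\<close> and \<open>b\<^sub>i = \<Theta>(s\<^sub>i, t\<^sub>i)\<close>.
  Each \<open>c\<^sub>i\<^sub>j\<close> is a finitely generated congruence, so only finitely many generators of \<open>F\<close> occur in it.
  By Kuratowski's free set theorem (\<open>exists_free_triple\<close>) there are distinct \<open>i, j, k\<close> such that none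
  of the three owns a generator that occurs in the refinement congruence of the other two.

  Since the variety contains a non-distributive lattice, it contains a lattice \<open>L\<close> in which an element
  \<open>y\<close> has two distinct complements \<open>x\<close> and \<open>z\<close>, named such that \<open>z\<close> is not below \<open>x\<close>
  (\<open>two_complements_lattice\<close>). Send \<open>F\<close> to \<open>L\<close> such that
  \<open>[s\<^sub>i, t\<^sub>i] \<mapsto> [0, x]\<close>, \<open>[s\<^sub>j, t\<^sub>j] \<mapsto> [y, 1]\<close> and \<open>[s\<^sub>k, t\<^sub>k] \<mapsto> [0, z]\<close>. The generators other than those
  of \<open>k\<close> map into the Boolean lattice \<open>{0, x, y, 1}\<close>, and there \<open>[0, x]\<close> and \<open>[y, 1]\<close> are transposed
  intervals, so that \<open>a\<^sub>i, a\<^sub>j\<close> collapse the same coordinate and \<open>b\<^sub>i, b\<^sub>j\<close> the other one: \<open>c\<^sub>i\<^sub>j\<close>, which is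
  below both joins, becomes trivial. The same holds for \<open>c\<^sub>j\<^sub>k\<close> with \<open>z\<close> in place of \<open>x\<close>, hence also for
  \<open>c\<^sub>i\<^sub>k\<close>. But on the generators other than those of \<open>j\<close> only \<open>0, x, z, 1\<close> occur as values, and the cut
  between the elements below \<open>x\<close> and those above \<open>z\<close> is a homomorphism onto the two-element chain
  that kills \<open>b\<^sub>i\<close>, \<open>a\<^sub>k\<close> and, by what was just seen, \<open>c\<^sub>i\<^sub>k\<close>, but not \<open>e\<close>. This contradicts
  \<open>e \<le> a\<^sub>k \<squnion> b\<^sub>i \<squnion> c\<^sub>i\<^sub>k\<close> (\<open>no_V_distance\<close>).

  Finally, an isomorphism between the congruence lattice of \<open>F\<close> and that of an algebra \<open>A\<close> restricts
  to the compact congruences, and almost permutability makes the map that takes two elements of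
  \<open>A\<close> to the principal congruence identifying them a V-distance of type \<open>3/2\<close>.\<close>

section \<open>Free sets above the first uncountable cardinal\<close>

unbundle cardinal_syntax

lemma not_ordLess_cardSuc_natLeq_iff:
  "\<not> cardSuc natLeq <o |A| \<longleftrightarrow> |A| \<le>o cardSuc natLeq"
  using not_ordLess_iff_ordLeq[OF card_of_Well_order[of A], of "cardSuc natLeq"]
    cardSuc_Card_order[OF natLeq_Card_order] by (simp add: card_order_on_well_order_on)

lemma infinite_Field_cardSuc_natLeq: "infinite (Field (cardSuc natLeq))"
  using cardSuc_finite[OF natLeq_Card_order] by (simp add: Field_natLeq)

lemma ordLeq_UNION:
  assumes "|T| \<le>o cardSuc natLeq" "\<And>t. t \<in> T \<Longrightarrow> |A t| \<le>o cardSuc natLeq"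
  shows "|\<Union>t\<in>T. A t| \<le>o cardSuc natLeq"
  using card_of_UNION_ordLeq_infinite_Field[OF infinite_Field_cardSuc_natLeq
      cardSuc_Card_order[OF natLeq_Card_order]] assms by blast

lemma countable_ordLeq_cardSuc: "countable A \<Longrightarrow> |A| \<le>o cardSuc natLeq"
  unfolding countable_card_le_natLeq by (rule ordLeq_transitive[OF _ cardSuc_ordLeq[OF natLeq_Card_order]])

lemma large_fibre:
  assumes large: "cardSuc natLeq <o |I|" and T: "finite T" "f ` I \<subseteq> T"
  shows "\<exists>t. cardSuc natLeq <o |{i \<in> I. f i = t}|"
proof (rule ccontr)
  assume "\<not> ?thesis"
  then have "|\<Union>t\<in>T. {i \<in> I. f i = t}| \<le>o cardSuc natLeq"
    by (intro ordLeq_UNION[OF countable_ordLeq_cardSuc[OF countable_finite[OF T(1)]]])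
      (auto simp: not_ordLess_cardSuc_natLeq_iff)
  moreover have "(\<Union>t\<in>T. {i \<in> I. f i = t}) = I" using T(2) by blast
  ultimately show False using large not_ordLess_cardSuc_natLeq_iff[of I] by simp
qed

text \<open>Kuratowski's free set theorem for pairs. A subset \<open>A\<close> of size \<open>\<aleph>\<^sub>1\<close> has only \<open>\<aleph>\<^sub>1\<close> elements in the
  union of all \<open>\<Phi> i j\<close> with \<open>i, j \<in> A\<close>, which leaves room for \<open>k\<close>. With \<open>k\<close> fixed, a countably infinite
  \<open>B \<subseteq> A\<close> leaves room for \<open>i \<in> A\<close> outside all \<open>\<Phi> j k\<close> with \<open>j \<in> B\<close>, and then \<open>j\<close> can be found in the
  infinite set \<open>B\<close> outside the finite set \<open>\<Phi> i k\<close>.\<close>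
lemma exists_free_triple:
  assumes large: "cardSuc natLeq <o |I|"
    and fin: "\<And>i j. i \<in> I \<Longrightarrow> j \<in> I \<Longrightarrow> finite (\<Phi> i j)"
  obtains i j k where "i \<in> I" "j \<in> I" "k \<in> I" "i \<noteq> j" "i \<noteq> k" "j \<noteq> k"
    "k \<notin> \<Phi> i j" "i \<notin> \<Phi> j k" "j \<notin> \<Phi> i k"
proof -
  let ?al = "cardSuc natLeq"
  have co: "Card_order ?al" by (simp add: cardSuc_Card_order natLeq_Card_order)
  have "|Field ?al| \<le>o |I|"
    using large co card_of_Field_ordIso ordIso_ordLeq_trans ordLess_imp_ordLeq by blast
  then obtain A where A: "A \<subseteq> I" "|Field ?al| =o |A|"
    using internalize_card_of_ordLeq2[of "Field ?al" I] by auto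
  have Aal: "|A| =o ?al"
    using A(2) co card_of_Field_ordIso ordIso_symmetric ordIso_transitive by blast
  have Ale: "|A| \<le>o ?al" using Aal by (simp add: ordIso_iff_ordLeq)
  have unc: "\<not> countable A"
  proof
    assume "countable A"
    then have "?al \<le>o natLeq"
      unfolding countable_card_le_natLeq using Aal ordIso_symmetric ordIso_ordLeq_trans by blast
    then show False using cardSuc_greater[OF natLeq_Card_order] not_ordLess_ordLeq by blast
  qed
  have "|\<Union>j\<in>A. \<Phi> i j| \<le>o ?al" if "i \<in> A" for i
    by (rule ordLeq_UNION[OF Ale])
      (use fin A(1) that in \<open>blast intro: countable_ordLeq_cardSuc countable_finite\<close>)
  then have "|\<Union>i\<in>A. \<Union>j\<in>A. \<Phi> i j| \<le>o ?al" by (rule ordLeq_UNION[OF Ale])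
  then have "|\<Union>b\<in>{True, False}. if b then A else (\<Union>i\<in>A. \<Union>j\<in>A. \<Phi> i j)| \<le>o ?al"
    by (intro ordLeq_UNION[OF countable_ordLeq_cardSuc[OF countable_finite]]) (use Ale in auto)
  then have "|A \<union> (\<Union>i\<in>A. \<Union>j\<in>A. \<Phi> i j)| \<le>o ?al" by (simp add: Un_commute)
  then have "\<not> I \<subseteq> A \<union> (\<Union>i\<in>A. \<Union>j\<in>A. \<Phi> i j)"
    using large not_ordLess_cardSuc_natLeq_iff[of I] card_of_mono1 ordLeq_transitive by blast
  then obtain k where k: "k \<in> I" "k \<notin> A" "\<And>i j. i \<in> A \<Longrightarrow> j \<in> A \<Longrightarrow> k \<notin> \<Phi> i j" by blast
  obtain B where B: "B \<subseteq> A" "countable B" "infinite B"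
    using infinite_countable_subset'[OF uncountable_infinite[OF unc]] by blast
  have "countable (B \<union> (\<Union>j\<in>B. \<Phi> j k))"
    by (intro countable_Un countable_UN B(2) countable_finite[OF fin] k(1)) (use B(1) A(1) in auto)
  then have "\<not> A \<subseteq> B \<union> (\<Union>j\<in>B. \<Phi> j k)"
    using unc countable_subset[of A "B \<union> (\<Union>j\<in>B. \<Phi> j k)"] by auto
  then obtain i where i0: "i \<in> A" "i \<notin> B \<union> (\<Union>j\<in>B. \<Phi> j k)" by (meson subsetI)
  then have i: "i \<in> A" "i \<notin> B" "\<And>j. j \<in> B \<Longrightarrow> i \<notin> \<Phi> j k" by auto
  have "finite (\<Phi> i k)" by (rule fin) (use i(1) A(1) k(1) in auto)
  then have "\<not> B \<subseteq> \<Phi> i k" using B(3) finite_subset[of B "\<Phi> i k"] by auto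
  then obtain j where j: "j \<in> B" "j \<notin> \<Phi> i k" by blast
  have "i \<in> I" "j \<in> A" "j \<in> I" "i \<noteq> j" "i \<noteq> k" "j \<noteq> k" using i(1,2) j(1) k(2) B(1) A(1) by auto
  then show thesis by (intro that[of i j k] k(1,3) i j)
qed

section \<open>Uniform refinement from a distance\<close>

lemma least_finite_sup:
  fixes S (structure)
  assumes "upper_semilattice S" "weak_partial_order_bottom S" "finite D" "D \<subseteq> carrier S"
  shows "least S (\<Squnion>D) (Upper S D)"
proof (cases "D = {}")
  case True
  then show ?thesis
    using weak_partial_order_bottom.bottom_least[OF assms(2)]
    by (simp add: sup_def bottom_def)
next
  case False
  interpret upper_semilattice S by fact
  show ?thesis using False assms(3,4) by (rule_tac finite_sup_least)
qed

text \<open>The elements \<open>c i j\<close> measure how far apart the interpolating points chosen for \<open>i\<close> and \<open>j\<close> are. Two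
  indices that go through \<open>a\<close> and \<open>b\<close> in the same order have their points within \<open>a i \<squnion> a j\<close> of each
  other at one end and within \<open>b i \<squnion> b j\<close> at the other end; which end is which does not affect the
  pair of inequalities, and this symmetry is what makes type \<open>3/2\<close> as good as a distance with a
  prescribed order, once a single pattern of orders has been selected.\<close>
lemma uniform_refinement:
  fixes S (structure)
  assumes S: "upper_semilattice S" "weak_partial_order_bottom S"
    and V: "V_distance_three_halves S X \<delta>" and gen: "range_join_generates S X \<delta>"
    and e: "e \<in> carrier S" and ab: "\<And>i. i \<in> I \<Longrightarrow> a i \<in> carrier S \<and> b i \<in> carrier S"
    and cover: "\<And>i. i \<in> I \<Longrightarrow> e \<sqsubseteq> a i \<squnion> b i"
    and large: "cardSuc natLeq <o |I|"
  obtains J c where "J \<subseteq> I" "cardSuc natLeq <o |J|"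
    "\<forall>i\<in>J. \<forall>j\<in>J. c i j \<in> carrier S \<and> c i j \<sqsubseteq> a i \<squnion> a j \<and> c i j \<sqsubseteq> b i \<squnion> b j \<and>
       e \<sqsubseteq> (a j \<squnion> b i) \<squnion> c i j"
    "\<forall>i\<in>J. \<forall>j\<in>J. \<forall>k\<in>J. c i k \<sqsubseteq> c i j \<squnion> c j k"
proof -
  interpret upper_semilattice S by fact
  have dist: "\<delta> x y \<in> carrier S" "\<delta> x y = \<delta> y x" if "x \<in> X" "y \<in> X" for x y
    using V that unfolding V_distance_three_halves_def S_valued_distance_def by blast+
  have tri: "\<delta> x z \<sqsubseteq> \<delta> x y \<squnion> \<delta> y z" if "x \<in> X" "y \<in> X" "z \<in> X" for x y z
    using V that unfolding V_distance_three_halves_def S_valued_distance_def by blast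
  have split: "\<exists>z\<in>X. (\<delta> x z \<sqsubseteq> s \<and> \<delta> z y \<sqsubseteq> t) \<or> (\<delta> x z \<sqsubseteq> t \<and> \<delta> z y \<sqsubseteq> s)"
    if "x \<in> X" "y \<in> X" "s \<in> carrier S" "t \<in> carrier S" "\<delta> x y \<sqsubseteq> s \<squnion> t" for x y s t
    using V that unfolding V_distance_three_halves_def by blast
  obtain D where D: "finite D" "D \<subseteq> {\<delta> x y |x y. x \<in> X \<and> y \<in> X}" "e = \<Squnion>D"
    using gen e unfolding range_join_generates_def by blast
  have Dc: "D \<subseteq> carrier S" using D(2) dist(1) by auto
  have supD: "least S e (Upper S D)" using least_finite_sup[OF S D(1) Dc] D(3) by simp
  have "\<forall>d\<in>D. \<exists>w. fst w \<in> X \<and> snd w \<in> X \<and> \<delta> (fst w) (snd w) = d"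
  proof
    fix d assume "d \<in> D"
    then obtain x y where "x \<in> X" "y \<in> X" "d = \<delta> x y" using D(2) by blast
    then show "\<exists>w. fst w \<in> X \<and> snd w \<in> X \<and> \<delta> (fst w) (snd w) = d"
      by (intro exI[of _ "(x, y)"]) simp
  qed
  from bchoice[OF this] obtain w
    where w: "\<forall>d\<in>D. fst (w d) \<in> X \<and> snd (w d) \<in> X \<and> \<delta> (fst (w d)) (snd (w d)) = d"
    by (rule exE)
  define p q where "p d = fst (w d)" and "q d = snd (w d)" for d
  have pq: "p d \<in> X" "q d \<in> X" "\<delta> (p d) (q d) = d" if "d \<in> D" for d
    using bspec[OF w that] by (simp_all add: p_def q_def)
  \<comment> \<open>the two orders in which \<open>a i\<close> and \<open>b i\<close> may be used on the way from \<open>p d\<close> to \<open>q d\<close>\<close>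
  define fst_way where "fst_way i d z \<longleftrightarrow> \<delta> (p d) z \<sqsubseteq> a i \<and> \<delta> z (q d) \<sqsubseteq> b i" for i d z
  define snd_way where "snd_way i d z \<longleftrightarrow> \<delta> (p d) z \<sqsubseteq> b i \<and> \<delta> z (q d) \<sqsubseteq> a i" for i d z
  have "\<exists>z\<in>X. fst_way i d z \<or> snd_way i d z" if "i \<in> I" "d \<in> D" for i d
  proof -
    have "d \<sqsubseteq> e" using least_Upper_above[OF supD that(2)] Dc by simp
    then have "d \<sqsubseteq> a i \<squnion> b i" using cover[OF that(1)] that Dc e ab by (meson join_closed le_trans subsetD)
    then have "\<delta> (p d) (q d) \<sqsubseteq> a i \<squnion> b i" using pq[OF that(2)] by simp
    then show ?thesis unfolding fst_way_def snd_way_def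
      using split[OF pq(1,2)[OF that(2)]] ab[OF that(1)] by blast
  qed
  then have "\<forall>i\<in>I. \<exists>g. \<forall>d\<in>D. g d \<in> X \<and> (fst_way i d (g d) \<or> snd_way i d (g d))"
    by (intro ballI bchoice) blast
  from bchoice[OF this] obtain z
    where z: "\<forall>i\<in>I. \<forall>d\<in>D. z i d \<in> X \<and> (fst_way i d (z i d) \<or> snd_way i d (z i d))"
    by (rule exE)
  \<comment> \<open>The pattern of \<open>i\<close>: the set of those \<open>d\<close> for which the first order works.\<close>
  define f where "f i = {d \<in> D. fst_way i d (z i d)}" for i
  have "f ` I \<subseteq> Pow D" by (auto simp: f_def)
  then obtain t where t: "cardSuc natLeq <o |{i \<in> I. f i = t}|"
    using large_fibre[OF large, of "Pow D" f] D(1) by auto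
  define J where "J = {i \<in> I. f i = t}"
  have way: "if d \<in> t then fst_way i d (z i d) else snd_way i d (z i d)" if "i \<in> J" "d \<in> D" for i d
    using z that unfolding J_def f_def by auto
  define c where "c i j = \<Squnion>((\<lambda>d. \<delta> (z i d) (z j d)) ` D)" for i j
  have zX: "z i d \<in> X" if "i \<in> J" "d \<in> D" for i d using z that J_def by auto
  have c: "least S (c i j) (Upper S ((\<lambda>d. \<delta> (z i d) (z j d)) ` D))" if "i \<in> J" "j \<in> J" for i j
    unfolding c_def by (rule least_finite_sup[OF S]) (use D(1) zX that dist in auto)
  have cc: "c i j \<in> carrier S" if "i \<in> J" "j \<in> J" for i j using c[OF that] by (rule least_closed)
  have c_above: "\<delta> (z i d) (z j d) \<sqsubseteq> c i j" if "i \<in> J" "j \<in> J" "d \<in> D" for i j d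
    by (rule least_Upper_above[OF c[OF that(1,2)]]) (use that zX dist in auto)
  have c_least: "c i j \<sqsubseteq> u"
    if "i \<in> J" "j \<in> J" "u \<in> carrier S" "\<And>d. d \<in> D \<Longrightarrow> \<delta> (z i d) (z j d) \<sqsubseteq> u" for i j u
    by (rule least_le[OF c[OF that(1,2)]]) (use that in \<open>auto simp: Upper_def\<close>)
  have J: "i \<in> I" "a i \<in> carrier S" "b i \<in> carrier S" if "i \<in> J" for i using that ab J_def by auto
  have jm: "s \<squnion> u \<sqsubseteq> v" if "s \<sqsubseteq> v" "u \<sqsubseteq> v" "s \<in> carrier S" "u \<in> carrier S" "v \<in> carrier S" for s u v
    using that by (rule join_le)
  have via: "\<delta> x y \<sqsubseteq> u \<squnion> v"
    if "\<delta> x w \<sqsubseteq> u" "\<delta> w y \<sqsubseteq> v" "x \<in> X" "y \<in> X" "w \<in> X" "u \<in> carrier S" "v \<in> carrier S"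
    for x y w u v
  proof -
    have c: "\<delta> x w \<in> carrier S" "\<delta> w y \<in> carrier S" "\<delta> x y \<in> carrier S" using that dist(1) by auto
    have "\<delta> x w \<sqsubseteq> u \<squnion> v" "\<delta> w y \<sqsubseteq> u \<squnion> v"
      using that c join_left join_right by (meson join_closed le_trans)+
    then have "\<delta> x w \<squnion> \<delta> w y \<sqsubseteq> u \<squnion> v" using c that by (intro jm) auto
    then show ?thesis using tri[OF that(3,5,4)] c that by (meson join_closed le_trans)
  qed
  have first: "\<delta> (p d) (z i d) \<sqsubseteq> a i" "\<delta> (z i d) (p d) \<sqsubseteq> a i" "\<delta> (q d) (z i d) \<sqsubseteq> b i" "\<delta> (z i d) (q d) \<sqsubseteq> b i"
    if "i \<in> J" "d \<in> D" "d \<in> t" for i d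
    using way[OF that(1,2)] that(3) dist(2)[OF zX[OF that(1,2)] pq(1)[OF that(2)]]
      dist(2)[OF zX[OF that(1,2)] pq(2)[OF that(2)]]
    by (simp_all add: fst_way_def)
  have second: "\<delta> (p d) (z i d) \<sqsubseteq> b i" "\<delta> (z i d) (p d) \<sqsubseteq> b i" "\<delta> (q d) (z i d) \<sqsubseteq> a i" "\<delta> (z i d) (q d) \<sqsubseteq> a i"
    if "i \<in> J" "d \<in> D" "d \<notin> t" for i d
    using way[OF that(1,2)] that(3) dist(2)[OF zX[OF that(1,2)] pq(1)[OF that(2)]]
      dist(2)[OF zX[OF that(1,2)] pq(2)[OF that(2)]]
    by (simp_all add: snd_way_def)
  have join_assoc: "(s \<squnion> u) \<squnion> v = s \<squnion> (u \<squnion> v)"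
    if "s \<in> carrier S" "u \<in> carrier S" "v \<in> carrier S" for s u v
    using weak_join_assoc[OF that] by (simp add: eq_is_equal)
  have refine: "c i j \<sqsubseteq> a i \<squnion> a j" "c i j \<sqsubseteq> b i \<squnion> b j" "e \<sqsubseteq> (a j \<squnion> b i) \<squnion> c i j"
    "\<And>k. k \<in> J \<Longrightarrow> c i k \<sqsubseteq> c i j \<squnion> c j k" if ij: "i \<in> J" "j \<in> J" for i j
  proof -
    note c_ij = cc[OF ij] and J_ij = J(2,3)[OF ij(1)] J(2,3)[OF ij(2)]
    have X: "p d \<in> X" "q d \<in> X" "z i d \<in> X" "z j d \<in> X" if "d \<in> D" for d
      by (intro pq(1,2) zX ij that)+
    have both: "\<delta> (z i d) (z j d) \<sqsubseteq> a i \<squnion> a j \<and> \<delta> (z i d) (z j d) \<sqsubseteq> b i \<squnion> b j" if d: "d \<in> D" for d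
    proof (cases "d \<in> t")
      case True
      note to_i = first[OF ij(1) d True] and to_j = first[OF ij(2) d True]
      show ?thesis
        using via[OF to_i(2) to_j(1) X(3,4,1)[OF d] J_ij(1,3)]
          via[OF to_i(4) to_j(3) X(3,4,2)[OF d] J_ij(2,4)] by blast
    next
      case False
      note to_i = second[OF ij(1) d False] and to_j = second[OF ij(2) d False]
      show ?thesis
        using via[OF to_i(4) to_j(3) X(3,4,2)[OF d] J_ij(1,3)]
          via[OF to_i(2) to_j(1) X(3,4,1)[OF d] J_ij(2,4)] by blast
    qed
    show "c i j \<sqsubseteq> a i \<squnion> a j"
      by (rule c_least[OF ij]) (use J_ij both in simp_all)
    show "c i j \<sqsubseteq> b i \<squnion> b j"
      by (rule c_least[OF ij]) (use J_ij both in simp_all)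
    \<comment> \<open>The route from \<open>p d\<close> to \<open>q d\<close> uses the points of both indices. The one to be visited first is
      dictated by the pattern, as the part near \<open>j\<close> has to cost \<open>a j\<close> and the part near \<open>i\<close> has to
      cost \<open>b i\<close>.\<close>
    have "d \<sqsubseteq> (a j \<squnion> b i) \<squnion> c i j" if d: "d \<in> D" for d
    proof (cases "d \<in> t")
      case True
      have "\<delta> (z j d) (z i d) \<sqsubseteq> c i j" using c_above[OF ij d] dist(2)[OF X(3,4)[OF d]] by simp
      from via[OF this first(4)[OF ij(1) d True] X(4,2,3)[OF d] c_ij J_ij(2)]
      have "\<delta> (z j d) (q d) \<sqsubseteq> c i j \<squnion> b i" .
      from via[OF first(1)[OF ij(2) d True] this X(1,2,4)[OF d] J_ij(3)] c_ij J_ij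
      have "d \<sqsubseteq> a j \<squnion> (c i j \<squnion> b i)" using pq(3)[OF d] by simp
      also have "\<dots> = (a j \<squnion> b i) \<squnion> c i j" using c_ij J_ij by (simp add: join_assoc join_comm[of S "c i j" "b i"])
      finally show ?thesis .
    next
      case False
      from via[OF c_above[OF ij d] second(4)[OF ij(2) d False] X(3,2,4)[OF d] c_ij J_ij(3)]
      have "\<delta> (z i d) (q d) \<sqsubseteq> c i j \<squnion> a j" .
      from via[OF second(1)[OF ij(1) d False] this X(1,2,3)[OF d] J_ij(2)] c_ij J_ij
      have "d \<sqsubseteq> b i \<squnion> (c i j \<squnion> a j)" using pq(3)[OF d] by simp
      also have "\<dots> = c i j \<squnion> (a j \<squnion> b i)"
        using c_ij J_ij by (subst join_comm) (simp add: join_assoc)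
      also have "\<dots> = (a j \<squnion> b i) \<squnion> c i j" by (rule join_comm)
      finally show ?thesis .
    qed
    then show "e \<sqsubseteq> (a j \<squnion> b i) \<squnion> c i j" using c_ij J_ij by (intro least_le[OF supD]) (auto simp: Upper_def)
    show "c i k \<sqsubseteq> c i j \<squnion> c j k" if k: "k \<in> J" for k
      by (rule c_least[OF ij(1) k])
        (use cc ij k in \<open>auto intro!: via[OF c_above[OF ij] c_above[OF ij(2) k]] zX\<close>)
  qed
  show thesis
  proof (rule that[of J c])
    show "J \<subseteq> I" by (simp add: J_def)
    show "cardSuc natLeq <o |J|" using t by (simp add: J_def)
  qed (use cc refine in simp_all)
qed

section \<open>Non-distributive lattices are not cancellative\<close>

context lattice
begin

lemma le_meet_iff:
  "\<lbrakk>u \<in> carrier L; x \<in> carrier L; y \<in> carrier L\<rbrakk> \<Longrightarrow> u \<sqsubseteq> x \<sqinter> y \<longleftrightarrow> u \<sqsubseteq> x \<and> u \<sqsubseteq> y"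
  using meet_le meet_left meet_right le_trans by (meson meet_closed)

lemma join_le_iff:
  "\<lbrakk>u \<in> carrier L; x \<in> carrier L; y \<in> carrier L\<rbrakk> \<Longrightarrow> x \<squnion> y \<sqsubseteq> u \<longleftrightarrow> x \<sqsubseteq> u \<and> y \<sqsubseteq> u"
  using join_le join_left join_right le_trans by (meson join_closed)

lemma meet_leI:
  "\<lbrakk>x \<sqsubseteq> u \<or> y \<sqsubseteq> u; u \<in> carrier L; x \<in> carrier L; y \<in> carrier L\<rbrakk> \<Longrightarrow> x \<sqinter> y \<sqsubseteq> u"
  using meet_left meet_right le_trans by (meson meet_closed)

lemma le_joinI:
  "\<lbrakk>u \<sqsubseteq> x \<or> u \<sqsubseteq> y; u \<in> carrier L; x \<in> carrier L; y \<in> carrier L\<rbrakk> \<Longrightarrow> u \<sqsubseteq> x \<squnion> y"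
  using join_left join_right le_trans by (meson join_closed)

lemma le_antisym: "\<lbrakk>x \<sqsubseteq> y; y \<sqsubseteq> x; x \<in> carrier L; y \<in> carrier L\<rbrakk> \<Longrightarrow> x = y"
  using weak_le_antisym by (simp add: eq_is_equal)

text \<open>Half of the construction of a diamond from the lower median \<open>d\<close> and the upper median \<open>e\<close> of three
  elements of a modular lattice: pushed into the interval \<open>[d, e]\<close>, two of the elements meet in \<open>d\<close>.
  The other half is the dual statement. The position of \<open>d\<close> is described by inequalities because the
  lemma is applied to several permutations of the three elements, under which the formulas for the
  medians are not literally invariant.\<close>
lemma median_meet_le:
  assumes modular: "\<And>a b c. \<lbrakk>a \<in> carrier L; b \<in> carrier L; c \<in> carrier L; a \<sqsubseteq> c\<rbrakk> \<Longrightarrow> (a \<squnion> b) \<sqinter> c \<sqsubseteq> a \<squnion> (b \<sqinter> c)"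
    and C: "x \<in> carrier L" "y \<in> carrier L" "z \<in> carrier L" "e \<in> carrier L" "d \<in> carrier L"
    and d: "x \<sqinter> y \<sqsubseteq> d" "x \<sqinter> z \<sqsubseteq> d" "d \<sqsubseteq> y \<squnion> (x \<sqinter> z)"
  shows "((x \<sqinter> e) \<squnion> d) \<sqinter> ((y \<sqinter> e) \<squnion> d) \<sqsubseteq> d"
proof -
  define Y where "Y = (y \<sqinter> e) \<squnion> d"
  have Y: "Y \<in> carrier L" "d \<sqsubseteq> Y" using C by (simp_all add: Y_def join_right)
  have Yle: "Y \<sqsubseteq> (x \<sqinter> z) \<squnion> y"
    unfolding Y_def using C d(3) by (simp add: join_le_iff le_joinI meet_leI join_comm[of L y])
  have "(x \<sqinter> e) \<sqinter> Y \<sqsubseteq> ((x \<sqinter> z) \<squnion> y) \<sqinter> x"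
    using C Y Yle by (simp add: le_meet_iff meet_leI)
  also have "\<dots> \<sqsubseteq> (x \<sqinter> z) \<squnion> (y \<sqinter> x)" using C by (intro modular) (simp_all add: meet_left)
  also have "\<dots> \<sqsubseteq> d" using C d by (simp add: join_le_iff meet_comm[of L y])
  finally have 1: "(x \<sqinter> e) \<sqinter> Y \<sqsubseteq> d" using C Y by simp
  have "((x \<sqinter> e) \<squnion> d) \<sqinter> Y = (d \<squnion> (x \<sqinter> e)) \<sqinter> Y" by (simp add: join_comm[of L d])
  also have "\<dots> \<sqsubseteq> d \<squnion> ((x \<sqinter> e) \<sqinter> Y)" using C Y by (intro modular) simp_all
  also have "\<dots> \<sqsubseteq> d" using C Y 1 by (simp add: join_le_iff)
  finally show ?thesis unfolding Y_def using C by simp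
qed

end

text \<open>This combines the pentagon and the diamond. If cancellation held, it would give the modular law,
  the two sides of which have the same meet and the same join with the middle element. It would then
  identify two atoms of the diamond between the lower and the upper median of any three elements, the
  third atom being a common complement of both. So the medians would coincide, which is distributivity
  in the presence of the modular law.\<close>
lemma nondistributive_noncancellative:
  fixes L (structure)
  assumes "lattice L" and nd: "\<not> distributive L"
  shows "\<exists>x\<in>carrier L. \<exists>y\<in>carrier L. \<exists>z\<in>carrier L. x \<sqinter> y = z \<sqinter> y \<and> x \<squnion> y = z \<squnion> y \<and> \<not> z \<sqsubseteq> x"
proof (rule ccontr)
  assume neg: "\<not> ?thesis"
  interpret lattice L by fact
  have canc: "z \<sqsubseteq> x" if "x \<in> carrier L" "y \<in> carrier L" "z \<in> carrier L" "x \<sqinter> y = z \<sqinter> y" "x \<squnion> y = z \<squnion> y" for x y z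
    using neg that by blast
  have modular: "(a \<squnion> b) \<sqinter> c \<sqsubseteq> a \<squnion> (b \<sqinter> c)"
    if C: "a \<in> carrier L" "b \<in> carrier L" "c \<in> carrier L" "a \<sqsubseteq> c" for a b c
  proof (rule canc[of _ b])
    show "(a \<squnion> (b \<sqinter> c)) \<sqinter> b = (a \<squnion> b) \<sqinter> c \<sqinter> b"
    proof (rule le_antisym)
      show "(a \<squnion> (b \<sqinter> c)) \<sqinter> b \<sqsubseteq> (a \<squnion> b) \<sqinter> c \<sqinter> b"
        using C by (simp add: le_meet_iff meet_leI join_le_iff le_joinI)
      show "(a \<squnion> b) \<sqinter> c \<sqinter> b \<sqsubseteq> (a \<squnion> (b \<sqinter> c)) \<sqinter> b"
        using C by (simp add: le_meet_iff meet_leI le_joinI)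
    qed (use C in simp_all)
    show "a \<squnion> (b \<sqinter> c) \<squnion> b = (a \<squnion> b) \<sqinter> c \<squnion> b"
    proof (rule le_antisym)
      show "a \<squnion> (b \<sqinter> c) \<squnion> b \<sqsubseteq> (a \<squnion> b) \<sqinter> c \<squnion> b"
        using C by (simp add: le_meet_iff meet_leI join_le_iff le_joinI)
      show "(a \<squnion> b) \<sqinter> c \<squnion> b \<sqsubseteq> a \<squnion> (b \<sqinter> c) \<squnion> b"
        using C by (simp add: le_meet_iff meet_leI join_le_iff le_joinI)
    qed (use C in simp_all)
  qed (use C in simp_all)
  interpret D: lattice "inv_gorder L" by (rule dual_lattice)
  have comodular: "a \<sqinter> (b \<squnion> c) \<sqsubseteq> (a \<sqinter> b) \<squnion> c"
    if "a \<in> carrier L" "b \<in> carrier L" "c \<in> carrier L" "c \<sqsubseteq> a" for a b c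
    using modular[of c b a] that by (simp add: join_comm meet_comm)
  have dist: "x \<sqinter> (y \<squnion> z) = (x \<sqinter> y) \<squnion> (x \<sqinter> z)" if C: "x \<in> carrier L" "y \<in> carrier L" "z \<in> carrier L" for x y z
  proof -
    define d where "d = ((x \<sqinter> y) \<squnion> (x \<sqinter> z)) \<squnion> (y \<sqinter> z)"
    define e where "e = ((x \<squnion> y) \<sqinter> (x \<squnion> z)) \<sqinter> (y \<squnion> z)"
    have de: "d \<in> carrier L" "e \<in> carrier L" using C by (simp_all add: d_def e_def)
    have "d \<sqsubseteq> e" unfolding d_def e_def using C by (simp add: le_meet_iff meet_leI join_le_iff le_joinI)
    define g where "g u = (u \<sqinter> e) \<squnion> d" for u
    have g: "g u \<in> carrier L" if "u \<in> carrier L" for u using that de by (simp add: g_def)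
    have dual: "(u \<squnion> d) \<sqinter> e \<sqsubseteq> g u" if "u \<in> carrier L" for u
      using modular[of d u e] that de \<open>d \<sqsubseteq> e\<close> by (simp add: g_def join_comm)
    have meets: "g u \<sqinter> g v = d"
      if "u \<in> carrier L" "v \<in> carrier L" "w \<in> carrier L" "u \<sqinter> v \<sqsubseteq> d" "u \<sqinter> w \<sqsubseteq> d" "d \<sqsubseteq> v \<squnion> (u \<sqinter> w)" for u v w
      using median_meet_le[OF modular, of u v w e d] that de g
      by (intro le_antisym) (simp_all add: g_def le_meet_iff join_right)
    have joins: "g u \<squnion> g v = e"
      if "u \<in> carrier L" "v \<in> carrier L" "w \<in> carrier L" "e \<sqsubseteq> u \<squnion> v" "e \<sqsubseteq> u \<squnion> w" "v \<sqinter> (u \<squnion> w) \<sqsubseteq> e" for u v w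
    proof -
      have "e \<sqsubseteq> ((u \<squnion> d) \<sqinter> e) \<squnion> ((v \<squnion> d) \<sqinter> e)"
        using D.median_meet_le[of u v w d e] comodular that de by (simp add: join_comm meet_comm)
      also have "\<dots> \<sqsubseteq> g u \<squnion> g v" using dual[of u] dual[of v] that de g by (simp add: join_le_iff le_joinI)
      finally show ?thesis using that de g \<open>d \<sqsubseteq> e\<close>
        by (intro le_antisym) (simp_all add: join_le_iff, simp_all add: g_def join_le_iff meet_right)
    qed
    have ineq: "x \<sqinter> y \<sqsubseteq> d" "x \<sqinter> z \<sqsubseteq> d" "z \<sqinter> y \<sqsubseteq> d" "z \<sqinter> x \<sqsubseteq> d"
      "d \<sqsubseteq> y \<squnion> (x \<sqinter> z)" "d \<sqsubseteq> y \<squnion> (z \<sqinter> x)" "d \<sqsubseteq> z \<squnion> (x \<sqinter> y)"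
      unfolding d_def using C by (simp_all add: le_meet_iff meet_leI join_le_iff le_joinI)
    have ineq': "e \<sqsubseteq> x \<squnion> y" "e \<sqsubseteq> x \<squnion> z" "e \<sqsubseteq> z \<squnion> y" "e \<sqsubseteq> z \<squnion> x"
      "y \<sqinter> (x \<squnion> z) \<sqsubseteq> e" "y \<sqinter> (z \<squnion> x) \<sqsubseteq> e" "z \<sqinter> (x \<squnion> y) \<sqsubseteq> e"
      unfolding e_def using C by (simp_all add: le_meet_iff meet_leI join_le_iff le_joinI)
    have xy: "g x \<sqinter> g y = d" "g x \<squnion> g y = e" and zy: "g z \<sqinter> g y = d" "g z \<squnion> g y = e"
      and xz: "g x \<sqinter> g z = d" "g x \<squnion> g z = e"
      using meets[of x y z] meets[of z y x] meets[of x z y] joins[of x y z] joins[of z y x] joins[of x z y]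
        C ineq ineq' by blast+
    have "g x = g z" using canc[of "g x" "g y" "g z"] canc[of "g z" "g y" "g x"] xy zy g C by (intro le_antisym) simp_all
    then have "e \<sqsubseteq> d" using xz g[OF C(1)] join_le[of "g x" "g x" "g x"] meet_le[of "g x" "g x" "g x"]
      by (metis le_refl le_trans meet_closed join_closed)
    have "x \<sqinter> (y \<squnion> z) \<sqsubseteq> e" unfolding e_def using C by (simp add: le_meet_iff meet_leI join_le_iff le_joinI)
    then have "x \<sqinter> (y \<squnion> z) \<sqsubseteq> d" using \<open>e \<sqsubseteq> d\<close> C de by (meson le_trans meet_closed join_closed)
    then have "x \<sqinter> (y \<squnion> z) \<sqsubseteq> (((x \<sqinter> y) \<squnion> (x \<sqinter> z)) \<squnion> (y \<sqinter> z)) \<sqinter> x"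
      unfolding d_def using C by (simp add: le_meet_iff meet_left)
    also have "\<dots> \<sqsubseteq> ((x \<sqinter> y) \<squnion> (x \<sqinter> z)) \<squnion> ((y \<sqinter> z) \<sqinter> x)"
      using C by (intro modular) (simp_all add: join_le_iff meet_left)
    also have "\<dots> \<sqsubseteq> (x \<sqinter> y) \<squnion> (x \<sqinter> z)"
      using C by (simp add: le_meet_iff meet_leI join_le_iff le_joinI)
    finally show ?thesis
      using C by (intro le_antisym) (simp_all add: le_meet_iff meet_leI join_le_iff le_joinI)
  qed
  then show False using nd unfolding distributive_def by blast
qed

lemma join_eqI:
  fixes L (structure)
  assumes "lattice L" "x \<in> carrier L" "y \<in> carrier L" "s \<in> carrier L" "x \<sqsubseteq> s" "y \<sqsubseteq> s"
    "\<And>u. \<lbrakk>u \<in> carrier L; x \<sqsubseteq> u; y \<sqsubseteq> u\<rbrakk> \<Longrightarrow> s \<sqsubseteq> u"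
  shows "x \<squnion> y = s"
proof -
  interpret lattice L by fact
  show ?thesis using assms by (intro le_antisym) (simp_all add: join_le_iff join_left join_right)
qed

lemma meet_eqI:
  fixes L (structure)
  assumes "lattice L" "x \<in> carrier L" "y \<in> carrier L" "s \<in> carrier L" "s \<sqsubseteq> x" "s \<sqsubseteq> y"
    "\<And>u. \<lbrakk>u \<in> carrier L; u \<sqsubseteq> x; u \<sqsubseteq> y\<rbrakk> \<Longrightarrow> u \<sqsubseteq> s"
  shows "x \<sqinter> y = s"
proof -
  interpret lattice L by fact
  show ?thesis using assms by (intro le_antisym) (simp_all add: le_meet_iff meet_left meet_right)
qed

section \<open>Generated sublattices and their copies\<close>

inductive_set gen :: "('a, 'm) gorder_scheme \<Rightarrow> 'a set \<Rightarrow> 'a set" for L U where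
  base: "u \<in> U \<Longrightarrow> u \<in> gen L U"
| join: "p \<in> gen L U \<Longrightarrow> q \<in> gen L U \<Longrightarrow> p \<squnion>\<^bsub>L\<^esub> q \<in> gen L U"
| meet: "p \<in> gen L U \<Longrightarrow> q \<in> gen L U \<Longrightarrow> p \<sqinter>\<^bsub>L\<^esub> q \<in> gen L U"

lemma gen_subset_carrier: "lattice L \<Longrightarrow> U \<subseteq> carrier L \<Longrightarrow> gen L U \<subseteq> carrier L"
proof
  fix p assume L: "lattice L" "U \<subseteq> carrier L" and "p \<in> gen L U"
  interpret lattice L by fact
  show "p \<in> carrier L" using \<open>p \<in> gen L U\<close> by induction (use L in auto)
qed

lemma gen_mono:
  assumes "U \<subseteq> V"
  shows "gen L U \<subseteq> gen L V"
proof
  fix p assume "p \<in> gen L U"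
  then show "p \<in> gen L V" by induction (use assms in \<open>auto intro: gen.intros\<close>)
qed

lemma gen_finite_support:
  assumes "p \<in> gen L U"
  shows "\<exists>T. finite T \<and> T \<subseteq> U \<and> p \<in> gen L T"
  using assms
proof induction
  case (base u)
  then show ?case by (intro exI[of _ "{u}"]) (auto intro: gen.base)
next
  case (join p q)
  then obtain T T' where "finite (T \<union> T')" "T \<union> T' \<subseteq> U" "p \<in> gen L (T \<union> T')" "q \<in> gen L (T \<union> T')"
    by (meson Un_least finite_Un gen_mono in_mono sup_ge1 sup_ge2)
  then show ?case by (meson gen.join)
next
  case (meet p q)
  then obtain T T' where "finite (T \<union> T')" "T \<union> T' \<subseteq> U" "p \<in> gen L (T \<union> T')" "q \<in> gen L (T \<union> T')"
    by (meson Un_least finite_Un gen_mono in_mono sup_ge1 sup_ge2)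
  then show ?case by (meson gen.meet)
qed

lemma gen_finite_set_support:
  assumes "finite R" "R \<subseteq> gen L U"
  shows "\<exists>T. finite T \<and> T \<subseteq> U \<and> R \<subseteq> gen L T"
  using assms
proof (induction R)
  case empty
  then show ?case by blast
next
  case (insert p R)
  then obtain T T' where "finite (T \<union> T')" "T \<union> T' \<subseteq> U" "R \<subseteq> gen L T" "p \<in> gen L T'"
    using gen_finite_support by (metis finite_Un insert_subset le_sup_iff)
  moreover have "gen L T \<subseteq> gen L (T \<union> T')" "gen L T' \<subseteq> gen L (T \<union> T')" by (simp_all add: gen_mono)
  ultimately show ?case by blast
qed

instance lat_term :: countable by countable_datatype

lemma countable_gen:
  assumes "countable U"
  shows "countable (gen L U)"
proof (cases "U = {}")
  case True
  have "p \<notin> gen L {}" for p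
  proof
    assume "p \<in> gen L {}"
    then show False by induction auto
  qed
  then have "gen L {} = {}" by blast
  then show ?thesis using True by simp
next
  case False
  then have v: "range (from_nat_into U) = U" using assms by (rule range_from_nat_into)
  have "gen L U \<subseteq> range (lat_eval L (from_nat_into U))"
  proof
    fix p assume "p \<in> gen L U"
    then show "p \<in> range (lat_eval L (from_nat_into U))"
    proof induction
      case (base u)
      then obtain n where "u = from_nat_into U n" using v by blast
      then show ?case by (intro range_eqI[of _ _ "Var n"]) simp
    next
      case (join p q)
      then obtain s t where "p = lat_eval L (from_nat_into U) s" "q = lat_eval L (from_nat_into U) t" by blast
      then show ?case by (intro range_eqI[of _ _ "Join s t"]) simp
    next
      case (meet p q)
      then obtain s t where "p = lat_eval L (from_nat_into U) s" "q = lat_eval L (from_nat_into U) t" by blast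
      then show ?case by (intro range_eqI[of _ _ "Meet s t"]) simp
    qed
  qed
  then show ?thesis by (rule countable_subset) simp
qed

text \<open>The sublattice with carrier \<open>S\<close>, transported along an injection \<open>f\<close> to a possibly different element
  type. The transport is needed because the universal property of a free lattice speaks about test
  lattices over the element type of that lattice only. With \<open>f = id\<close> it is the sublattice itself.\<close>
definition sublattice_copy :: "'a gorder \<Rightarrow> 'a set \<Rightarrow> ('a \<Rightarrow> 'b) \<Rightarrow> 'b gorder" where
  "sublattice_copy L S f =
     \<lparr>carrier = f ` S, eq = (=), le = (\<lambda>p q. inv_into S f p \<sqsubseteq>\<^bsub>L\<^esub> inv_into S f q)\<rparr>"

lemma carrier_sublattice_copy [simp]: "carrier (sublattice_copy L S f) = f ` S"
  by (simp add: sublattice_copy_def)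

locale sublattice_inj = lattice L for L :: "'a gorder" (structure) +
  fixes S :: "'a set" and f :: "'a \<Rightarrow> 'b"
  assumes sub: "S \<subseteq> carrier L" and closed: "p \<in> S \<Longrightarrow> q \<in> S \<Longrightarrow> p \<squnion> q \<in> S" "p \<in> S \<Longrightarrow> q \<in> S \<Longrightarrow> p \<sqinter> q \<in> S"
    and inj: "inj_on f S"
begin

abbreviation "M \<equiv> sublattice_copy L S f"

lemma copy_le: "p \<in> S \<Longrightarrow> q \<in> S \<Longrightarrow> f p \<sqsubseteq>\<^bsub>M\<^esub> f q \<longleftrightarrow> p \<sqsubseteq> q"
  by (simp add: sublattice_copy_def inv_into_f_f[OF inj])

lemma subD: "p \<in> S \<Longrightarrow> p \<in> carrier L"
  using sub by blast

lemma lattice_copy: "lattice M"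
proof -
  interpret M: partial_order M
  proof
    fix a b c assume "a \<in> carrier M" "b \<in> carrier M" "c \<in> carrier M" "a \<sqsubseteq>\<^bsub>M\<^esub> b" "b \<sqsubseteq>\<^bsub>M\<^esub> c"
    then show "a \<sqsubseteq>\<^bsub>M\<^esub> c" using le_trans subD by (auto simp: copy_le)
  next
    fix a b assume "a \<in> carrier M" "b \<in> carrier M" "a \<sqsubseteq>\<^bsub>M\<^esub> b" "b \<sqsubseteq>\<^bsub>M\<^esub> a"
    then obtain p q where "p \<in> S" "q \<in> S" "a = f p" "b = f q" "p \<sqsubseteq> q" "q \<sqsubseteq> p" by (auto simp: copy_le)
    then have "a = b" using le_antisym[of p q] subD by simp
    then show "a .=\<^bsub>M\<^esub> b" by (simp add: sublattice_copy_def)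
  qed (auto simp: sublattice_copy_def subD inv_into_f_f[OF inj])
  show ?thesis
  proof
    fix a b assume "a \<in> carrier M" "b \<in> carrier M"
    then obtain p q where pq: "p \<in> S" "q \<in> S" "a = f p" "b = f q" by auto
    have "least M (f (p \<squnion> q)) (Upper M {a, b})"
      by (rule least_UpperI) (use pq closed subD in \<open>auto simp: copy_le Upper_def join_left join_right join_le_iff\<close>)
    then show "\<exists>s. least M s (Upper M {a, b})" by blast
    have "greatest M (f (p \<sqinter> q)) (Lower M {a, b})"
      by (rule greatest_LowerI) (use pq closed subD in \<open>auto simp: copy_le Lower_def meet_left meet_right le_meet_iff\<close>)
    then show "\<exists>s. greatest M s (Lower M {a, b})" by blast
  qed
qed

lemma copy_join: "p \<in> S \<Longrightarrow> q \<in> S \<Longrightarrow> f p \<squnion>\<^bsub>M\<^esub> f q = f (p \<squnion> q)"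
  using closed subD by (intro join_eqI[OF lattice_copy]) (auto simp: copy_le join_left join_right join_le_iff)

lemma copy_meet: "p \<in> S \<Longrightarrow> q \<in> S \<Longrightarrow> f p \<sqinter>\<^bsub>M\<^esub> f q = f (p \<sqinter> q)"
  using closed subD by (intro meet_eqI[OF lattice_copy]) (auto simp: copy_le meet_left meet_right le_meet_iff)

lemma copy_in_variety:
  assumes "in_variety E L"
  shows "in_variety E M"
proof -
  have "lat_eval M v s = lat_eval M v t" if st: "(s, t) \<in> E" and v: "v \<in> UNIV \<rightarrow> carrier M" for s t v
  proof -
    define w where "w i = inv_into S f (v i)" for i
    have w: "w i \<in> S" "f (w i) = v i" for i
      using v by (auto simp: w_def inv_into_into f_inv_into_f Pi_iff)
    have ev: "lat_eval L w r \<in> S \<and> lat_eval M v r = f (lat_eval L w r)" for r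
      by (induction r) (auto simp: w closed copy_join copy_meet)
    have "w \<in> UNIV \<rightarrow> carrier L" using w(1) subD by blast
    then show ?thesis using assms st ev unfolding in_variety_def by auto
  qed
  then show ?thesis using lattice_copy unfolding in_variety_def by blast
qed

end

lemma sublattice_injI_gen:
  fixes L :: "'a gorder"
  assumes "lattice L" "U \<subseteq> carrier L" "inj_on f (gen L U)"
  shows "sublattice_inj L (gen L U) f"
  using assms gen_subset_carrier[OF assms(1,2)]
  by (simp add: sublattice_inj_def sublattice_inj_axioms_def gen.join gen.meet)

section \<open>Homomorphisms from free lattices to a test lattice\<close>

lemma bounded_latticeI:
  fixes L (structure)
  assumes "lattice L" "b \<in> carrier L" "t \<in> carrier L" "\<And>p. p \<in> carrier L \<Longrightarrow> b \<sqsubseteq> p \<and> p \<sqsubseteq> t"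
  shows "bounded_lattice L" "\<bottom> = b" "\<top> = t"
proof -
  interpret lattice L by fact
  have "least L b (carrier L)" "greatest L t (carrier L)"
    using assms by (auto simp: least_def greatest_def)
  then show *: "bounded_lattice L" by unfold_locales blast+
  show "\<bottom> = b" "\<top> = t"
    using bounded_lattice.bottom_eq[OF *, of b] bounded_lattice.top_eq[OF *, of t] assms by auto
qed

text \<open>If \<open>x\<close> and \<open>z\<close> have the same meet and the same join with \<open>y\<close>, then these are the bounds of the
  sublattice generated by the three elements. That sublattice is countable, so it has a copy over any
  infinite type.\<close>
lemma two_complements_lattice:
  fixes N :: "'n gorder"
  assumes N: "in_variety E N" "\<not> distributive N" and inf: "infinite (UNIV :: 'f set)"
  obtains L :: "'f gorder" and x y z where "in_variety E L" "bounded_lattice L"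
    "x \<in> carrier L" "y \<in> carrier L" "z \<in> carrier L"
    "x \<sqinter>\<^bsub>L\<^esub> y = \<bottom>\<^bsub>L\<^esub>" "x \<squnion>\<^bsub>L\<^esub> y = \<top>\<^bsub>L\<^esub>" "z \<sqinter>\<^bsub>L\<^esub> y = \<bottom>\<^bsub>L\<^esub>" "z \<squnion>\<^bsub>L\<^esub> y = \<top>\<^bsub>L\<^esub>"
    "\<not> z \<sqsubseteq>\<^bsub>L\<^esub> x"
proof -
  have "lattice N" using N(1) by (simp add: in_variety_def)
  then interpret N: lattice N .
  obtain x y z where xyz: "x \<in> carrier N" "y \<in> carrier N" "z \<in> carrier N"
    and nc: "x \<sqinter>\<^bsub>N\<^esub> y = z \<sqinter>\<^bsub>N\<^esub> y" "x \<squnion>\<^bsub>N\<^esub> y = z \<squnion>\<^bsub>N\<^esub> y" "\<not> z \<sqsubseteq>\<^bsub>N\<^esub> x"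
    using nondistributive_noncancellative[OF \<open>lattice N\<close> N(2)] by blast
  let ?S = "gen N {x, y, z}" and ?b = "x \<sqinter>\<^bsub>N\<^esub> y" and ?t = "x \<squnion>\<^bsub>N\<^esub> y"
  have "countable ?S" by (simp add: countable_gen)
  then obtain i :: "'n \<Rightarrow> nat" where i: "inj_on i ?S" unfolding countable_def by blast
  obtain j :: "nat \<Rightarrow> 'f" where j: "inj j" using infinite_countable_subset[OF inf] by blast
  define f where "f = j \<circ> i"
  have f: "inj_on f ?S" unfolding f_def using i j by (simp add: comp_inj_on inj_on_subset)
  interpret sublattice_inj N ?S f
    by (rule sublattice_injI_gen[OF \<open>lattice N\<close> _ f]) (use xyz in auto)
  have S: "x \<in> ?S" "y \<in> ?S" "z \<in> ?S" by (auto intro: gen.base)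
  have mem: "?b \<in> ?S" "?t \<in> ?S" using S by (auto intro: gen.join gen.meet)
  have "?b \<sqsubseteq>\<^bsub>N\<^esub> p \<and> p \<sqsubseteq>\<^bsub>N\<^esub> ?t \<and> p \<in> carrier N" if "p \<in> ?S" for p
    using that
  proof induction
    case (base u)
    have "?b \<sqsubseteq>\<^bsub>N\<^esub> z" "z \<sqsubseteq>\<^bsub>N\<^esub> ?t" unfolding nc using xyz by (simp_all add: N.meet_left N.join_left)
    then show ?case using base xyz by (auto simp: N.meet_left N.meet_right N.join_left N.join_right)
  qed (use xyz in \<open>auto simp: N.le_meet_iff N.join_le_iff N.meet_leI N.le_joinI\<close>)
  then have bd: "f ?b \<sqsubseteq>\<^bsub>M\<^esub> p \<and> p \<sqsubseteq>\<^bsub>M\<^esub> f ?t" if "p \<in> carrier M" for p using that mem copy_le by auto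
  have bdd: "bounded_lattice M" and bot: "\<bottom>\<^bsub>M\<^esub> = f ?b" and top: "\<top>\<^bsub>M\<^esub> = f ?t"
    using bounded_latticeI[OF lattice_copy _ _ bd] mem by auto
  show thesis
    by (rule that[of M "f x" "f y" "f z"])
      (use bdd S copy_in_variety[OF N(1)] nc in \<open>simp_all add: copy_join copy_meet bot top copy_le\<close>)
qed

lemma hom_into_gen:
  fixes F :: "'f gorder"
  assumes "lattice F" "U \<subseteq> carrier F" "lattice_hom F (sublattice_copy F (gen F U) id) h"
  shows "lattice_hom F F h" "h \<in> carrier F \<rightarrow> gen F U"
proof -
  interpret sublattice_inj F "gen F U" id by (rule sublattice_injI_gen) (use assms in auto)
  show h: "h \<in> carrier F \<rightarrow> gen F U" using assms(3) by (simp add: lattice_hom_def)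
  have eq: "p \<squnion>\<^bsub>M\<^esub> q = p \<squnion>\<^bsub>F\<^esub> q" "p \<sqinter>\<^bsub>M\<^esub> q = p \<sqinter>\<^bsub>F\<^esub> q" if "p \<in> gen F U" "q \<in> gen F U" for p q
    using copy_join[OF that] copy_meet[OF that] by simp_all
  have "h p \<in> gen F U" if "p \<in> carrier F" for p using h that by blast
  then show "lattice_hom F F h"
    using assms(3) h sub assms(1) eq unfolding lattice_hom_def join_pres_def meet_pres_def by auto
qed

lemma lattice_hom_id: "lattice F \<Longrightarrow> lattice_hom F F (restrict id (carrier F))"
proof -
  assume "lattice F"
  interpret lattice F by fact
  show ?thesis using \<open>lattice F\<close> by (simp add: lattice_hom_def join_pres_def meet_pres_def)
qed

text \<open>A common interface to the free and the free bounded case. The bounds of a free bounded lattice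
  behave like additional generators with prescribed values; \<open>K0\<close> and \<open>K1\<close> collect them. They are
  empty in the free case. That \<open>F\<close> is generated by the generators follows from uniqueness in the universal
  property: the retraction of \<open>F\<close> to the generated sublattice has to be the identity.\<close>
lemma free_lattice_homs:
  fixes F :: "'f gorder"
  assumes "free_lattice E F G \<or> free_bounded_lattice E F G"
  obtains K0 K1 where "lattice F" "G \<subseteq> carrier F" "K0 \<subseteq> carrier F" "K1 \<subseteq> carrier F"
    "carrier F = gen F (G \<union> (K0 \<union> K1))"
    "\<And>(L :: 'f gorder) g. \<lbrakk>in_variety E L; bounded_lattice L; g \<in> G \<rightarrow> carrier L\<rbrakk> \<Longrightarrow>
       \<exists>h. lattice_hom F L h \<and> (\<forall>x\<in>G. h x = g x) \<and> (\<forall>x\<in>K0. h x = \<bottom>\<^bsub>L\<^esub>) \<and> (\<forall>x\<in>K1. h x = \<top>\<^bsub>L\<^esub>)"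
  using assms
proof (elim disjE)
  assume "free_lattice E F G"
  then have F: "in_variety E F" "G \<subseteq> carrier F"
    and ex1: "\<And>(L :: 'f gorder) g. \<lbrakk>in_variety E L; g \<in> G \<rightarrow> carrier L\<rbrakk> \<Longrightarrow>
      \<exists>!h. h \<in> extensional (carrier F) \<and> lattice_hom F L h \<and> (\<forall>x \<in> G. h x = g x)"
    unfolding free_lattice_def by blast+
  have L: "lattice F" using F by (simp add: in_variety_def)
  interpret sublattice_inj F "gen F G" id by (rule sublattice_injI_gen) (use F L in auto)
  have "id \<in> G \<rightarrow> carrier M" by (auto intro: gen.base)
  then obtain h where h: "h \<in> extensional (carrier F)" "lattice_hom F M h" "\<forall>x\<in>G. h x = id x"
    using ex1[OF copy_in_variety[OF F(1)]] by blast
  have "id \<in> G \<rightarrow> carrier F" using F by auto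
  from ex1[OF F(1) this] have "h = restrict id (carrier F)"
    using h hom_into_gen[OF L F(2) h(2)] lattice_hom_id[OF L] F(2)
    by (elim ex1E) (metis restrict_apply' restrict_extensional subsetD)
  then have "carrier F \<subseteq> gen F G" using hom_into_gen(2)[OF L F(2) h(2)] by (auto simp: Pi_iff)
  then have "carrier F = gen F (G \<union> ({} \<union> {}))" using sub by auto
  moreover have "\<exists>h. lattice_hom F L h \<and> (\<forall>x\<in>G. h x = g x) \<and> (\<forall>x\<in>{}. h x = \<bottom>\<^bsub>L\<^esub>) \<and> (\<forall>x\<in>{}. h x = \<top>\<^bsub>L\<^esub>)"
    if "in_variety E L" "bounded_lattice L" "g \<in> G \<rightarrow> carrier L" for L :: "'f gorder" and g
    using ex1[OF that(1,3)] by blast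
  ultimately show thesis by (intro that[of "{}" "{}"] L F(2)) auto
next
  assume "free_bounded_lattice E F G"
  then have F: "in_variety E F" "G \<subseteq> carrier F" "bounded_lattice F"
    and ex1: "\<And>(L :: 'f gorder) g. \<lbrakk>in_variety E L; bounded_lattice L; g \<in> G \<rightarrow> carrier L\<rbrakk> \<Longrightarrow>
      \<exists>!h. h \<in> extensional (carrier F) \<and> bounded_lattice_hom F L h \<and> (\<forall>x \<in> G. h x = g x)"
    unfolding free_bounded_lattice_def by blast+
  have L: "lattice F" using F by (simp add: in_variety_def)
  interpret B: bounded_lattice F by fact
  let ?U = "G \<union> ({\<bottom>\<^bsub>F\<^esub>} \<union> {\<top>\<^bsub>F\<^esub>})"
  have U: "?U \<subseteq> carrier F" using F(2) by auto
  interpret sublattice_inj F "gen F ?U" id by (rule sublattice_injI_gen) (use U L in auto)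
  have mem: "\<bottom>\<^bsub>F\<^esub> \<in> gen F ?U" "\<top>\<^bsub>F\<^esub> \<in> gen F ?U" by (auto intro: gen.base)
  have bd: "\<bottom>\<^bsub>F\<^esub> \<sqsubseteq>\<^bsub>M\<^esub> p \<and> p \<sqsubseteq>\<^bsub>M\<^esub> \<top>\<^bsub>F\<^esub>" if "p \<in> carrier M" for p
    using that copy_le[OF mem(1)] copy_le[OF _ mem(2)] subD by auto
  have bdd: "bounded_lattice M" and bot: "\<bottom>\<^bsub>M\<^esub> = \<bottom>\<^bsub>F\<^esub>" and top: "\<top>\<^bsub>M\<^esub> = \<top>\<^bsub>F\<^esub>"
    using bounded_latticeI[OF lattice_copy _ _ bd] mem by auto
  have "id \<in> G \<rightarrow> carrier M" by (auto intro: gen.base)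
  then obtain h where h: "h \<in> extensional (carrier F)" "bounded_lattice_hom F M h" "\<forall>x\<in>G. h x = id x"
    using ex1[OF copy_in_variety[OF F(1)] bdd] by blast
  have hM: "lattice_hom F M h" using h(2) by (simp add: bounded_lattice_hom_def)
  note hF = hom_into_gen[OF L U hM]
  have hb: "bounded_lattice_hom F F h" using h(2) hF(1) unfolding bounded_lattice_hom_def bot top by blast
  have idb: "bounded_lattice_hom F F (restrict id (carrier F))"
    using lattice_hom_id[OF L] by (simp add: bounded_lattice_hom_def)
  have "id \<in> G \<rightarrow> carrier F" using F by auto
  from ex1[OF F(1,3) this] have "h = restrict id (carrier F)"
    using h hb idb F(2) by (elim ex1E) (metis restrict_apply' restrict_extensional subsetD)
  then have "carrier F \<subseteq> gen F ?U" using hF(2) by (auto simp: Pi_iff)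
  then have "carrier F = gen F ?U" using sub by auto
  moreover have "\<exists>h. lattice_hom F L h \<and> (\<forall>x\<in>G. h x = g x) \<and> (\<forall>x\<in>{\<bottom>\<^bsub>F\<^esub>}. h x = \<bottom>\<^bsub>L\<^esub>) \<and> (\<forall>x\<in>{\<top>\<^bsub>F\<^esub>}. h x = \<top>\<^bsub>L\<^esub>)"
    if "in_variety E L" "bounded_lattice L" "g \<in> G \<rightarrow> carrier L" for L :: "'f gorder" and g
    using ex1[OF that] unfolding bounded_lattice_hom_def by blast
  ultimately show thesis using U by (intro that[of "{\<bottom>\<^bsub>F\<^esub>}" "{\<top>\<^bsub>F\<^esub>}"] L F(2)) auto
qed

context bounded_lattice
begin

lemma bounds_simps:
  assumes "p \<in> carrier L"
  shows "\<bottom> \<squnion> p = p" "p \<squnion> \<bottom> = p" "\<top> \<squnion> p = \<top>" "p \<squnion> \<top> = \<top>"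
    "\<bottom> \<sqinter> p = \<bottom>" "p \<sqinter> \<bottom> = \<bottom>" "\<top> \<sqinter> p = p" "p \<sqinter> \<top> = p"
  using assms bottom_join top_join bottom_meet top_meet
  by (simp_all add: eq_is_equal join_comm[of L p] meet_comm[of L p])

end

lemma lattice_homD:
  assumes "lattice_hom F L h" "p \<in> carrier F" "q \<in> carrier F"
  shows "h p \<in> carrier L" "h (p \<squnion>\<^bsub>F\<^esub> q) = h p \<squnion>\<^bsub>L\<^esub> h q" "h (p \<sqinter>\<^bsub>F\<^esub> q) = h p \<sqinter>\<^bsub>L\<^esub> h q"
  using assms by (auto simp: lattice_hom_def join_pres_def meet_pres_def)

section \<open>Kernels and compact congruences\<close>

definition hom_ker :: "('a, 'm) gorder_scheme \<Rightarrow> ('a \<Rightarrow> 'b) \<Rightarrow> ('a \<times> 'a) set" where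
  "hom_ker F h = {(p, q). p \<in> carrier F \<and> q \<in> carrier F \<and> h p = h q}"

lemma congruence_hom_ker:
  assumes "lattice F" "lattice_hom F L h"
  shows "congruence (lattice_alg F) (hom_ker F h)"
proof -
  interpret lattice F by fact
  have "equiv (carrier F) (hom_ker F h)"
    by (rule equivI) (auto simp: hom_ker_def refl_on_def sym_def trans_def)
  moreover have "(xs ! 0 \<squnion>\<^bsub>F\<^esub> xs ! 1, ys ! 0 \<squnion>\<^bsub>F\<^esub> ys ! 1) \<in> hom_ker F h \<and>
      (xs ! 0 \<sqinter>\<^bsub>F\<^esub> xs ! 1, ys ! 0 \<sqinter>\<^bsub>F\<^esub> ys ! 1) \<in> hom_ker F h"
    if "length xs = 2" "list_all2 (\<lambda>x y. (x, y) \<in> hom_ker F h) xs ys" for xs ys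
  proof -
    have "(xs ! 0, ys ! 0) \<in> hom_ker F h" "(xs ! 1, ys ! 1) \<in> hom_ker F h"
      using that list_all2_nthD[OF that(2), of 0] list_all2_nthD[OF that(2), of 1] by auto
    then show ?thesis by (simp add: hom_ker_def lattice_homD[OF assms(2)])
  qed
  ultimately show ?thesis unfolding congruence_def lattice_alg_def by simp
qed

lemma Conc_join_subset_iff:
  assumes A: "algebra A" and ab: "\<alpha> \<in> carrier (Conc A)" "\<beta> \<in> carrier (Conc A)" and th: "congruence A \<theta>"
  shows "\<alpha> \<squnion>\<^bsub>Conc A\<^esub> \<beta> \<subseteq> \<theta> \<longleftrightarrow> \<alpha> \<subseteq> \<theta> \<and> \<beta> \<subseteq> \<theta>"
proof -
  interpret upper_semilattice "Conc A" by (rule Conc_semilattice[OF A])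
  obtain P Q where P: "finite P" "P \<subseteq> carrier A \<times> carrier A" "\<alpha> = Cg A P"
    and Q: "finite Q" "Q \<subseteq> carrier A \<times> carrier A" "\<beta> = Cg A Q"
    using ab unfolding Conc_def by auto
  have "\<alpha> \<squnion>\<^bsub>Conc A\<^esub> \<beta> = Cg A (P \<union> Q)"
    using least_unique[OF sup_of_two_least[OF ab]] Conc_join[OF A P(1,2) Q(1,2)] P(3) Q(3)
    by (simp add: join_def)
  moreover have "P \<union> Q \<subseteq> carrier A \<times> carrier A" using P Q by blast
  ultimately show ?thesis
    using P Q Cg_le_iff[OF A _ th] by (metis Un_subset_iff)
qed

lemma congruence_Conc: "algebra A \<Longrightarrow> \<alpha> \<in> carrier (Conc A) \<Longrightarrow> congruence A \<alpha>"
  using congruence_Cg unfolding Conc_def by auto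

lemma le_Conc [simp]: "\<alpha> \<sqsubseteq>\<^bsub>Conc A\<^esub> \<beta> \<longleftrightarrow> \<alpha> \<subseteq> \<beta>"
  by (simp add: Conc_def)

text \<open>If \<open>h\<close> maps all generators into \<open>{\<bottom>, x, y, \<top>}\<close> with \<open>x\<close> and \<open>y\<close> complementary, then \<open>h\<close> is determined
  by its two coordinates in the Boolean lattice with four elements. Here \<open>f\<close> and \<open>g\<close> are these
  coordinates, again regarded as homomorphisms to \<open>L\<close>.\<close>
lemma complements_determine:
  fixes L :: "'b gorder" (structure)
  assumes F: "lattice F" "T \<subseteq> carrier F" and L: "bounded_lattice L" "\<bottom> \<noteq> \<top>"
    and h: "lattice_hom F L h" and f: "lattice_hom F L f" and g: "lattice_hom F L g"
    and xy: "x \<in> carrier L" "y \<in> carrier L" "x \<sqinter> y = \<bottom>" "x \<squnion> y = \<top>"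
    and T: "\<And>t. t \<in> T \<Longrightarrow> (h t, f t, g t) \<in> {(\<bottom>, \<bottom>, \<bottom>), (x, \<top>, \<bottom>), (y, \<bottom>, \<top>), (\<top>, \<top>, \<top>)}"
    and pq: "p \<in> gen F T" "q \<in> gen F T" "f p = f q" "g p = g q"
  shows "h p = h q"
proof -
  interpret L: bounded_lattice L by fact
  have xy': "y \<sqinter> x = \<bottom>" "y \<squnion> x = \<top>" using xy by (simp_all add: join_comm[of L y] meet_comm[of L y])
  have idem: "s \<squnion> s = s" "s \<sqinter> s = s" if "s \<in> carrier L" for s
    using that by (auto intro!: L.le_antisym simp: L.join_le_iff L.le_meet_iff L.join_left L.meet_left)
  note simps = xy xy' L.bounds_simps idem
  let ?Q = "{(\<bottom>, \<bottom>, \<bottom>), (x, \<top>, \<bottom>), (y, \<bottom>, \<top>), (\<top>, \<top>, \<top>)}"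
  have Q: "r \<in> carrier F \<and> (h r, f r, g r) \<in> ?Q" if "r \<in> gen F T" for r
    using that
  proof induction
    case (base u)
    then show ?case using T[OF base] F(2) by (intro conjI) auto
  next
    case (join r s)
    interpret lattice F by fact
    show ?case using join.IH
      by (simp only: lattice_homD[OF h] lattice_homD[OF f] lattice_homD[OF g] join_closed)
        (elim conjE insertE emptyE; simp add: simps)
  next
    case (meet r s)
    interpret lattice F by fact
    show ?case using meet.IH
      by (simp only: lattice_homD[OF h] lattice_homD[OF f] lattice_homD[OF g] meet_closed)
        (elim conjE insertE emptyE; simp add: simps)
  qed
  then show ?thesis using Q[OF pq(1)] Q[OF pq(2)] pq(3,4) L(2) by auto
qed

text \<open>If \<open>h\<close> maps each generator below \<open>x\<close> or above \<open>z\<close>, and \<open>z \<le> x\<close> fails, then the values of \<open>h\<close> split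
  into an ideal and a filter, and \<open>f\<close>, which tells the two apart, factors through \<open>h\<close>.\<close>
lemma cut_determined:
  fixes L :: "'b gorder" (structure)
  assumes F: "lattice F" "T \<subseteq> carrier F" and L: "bounded_lattice L"
    and h: "lattice_hom F L h" and f: "lattice_hom F L f"
    and xz: "x \<in> carrier L" "z \<in> carrier L" "\<not> z \<sqsubseteq> x"
    and T: "\<And>t. t \<in> T \<Longrightarrow> (f t = \<bottom> \<and> h t \<sqsubseteq> x) \<or> (f t = \<top> \<and> z \<sqsubseteq> h t)"
    and pq: "p \<in> gen F T" "q \<in> gen F T" "h p = h q"
  shows "f p = f q"
proof -
  interpret L: bounded_lattice L by fact
  have Q: "r \<in> carrier F \<and> ((f r = \<bottom> \<and> h r \<sqsubseteq> x) \<or> (f r = \<top> \<and> z \<sqsubseteq> h r))" if "r \<in> gen F T" for r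
    using that
  proof induction
    case (base u)
    then show ?case using T[OF base] F(2) by (intro conjI) auto
  next
    case (join r s)
    interpret lattice F by fact
    show ?case using join.IH xz lattice_homD[OF h, of r s] lattice_homD[OF f, of r s] lattice_homD(1)[OF h, of s s]
      by (auto simp: L.bounds_simps L.join_le_iff L.le_joinI)
  next
    case (meet r s)
    interpret lattice F by fact
    show ?case using meet.IH xz lattice_homD[OF h, of r s] lattice_homD[OF f, of r s] lattice_homD(1)[OF h, of s s]
      by (auto simp: L.bounds_simps L.le_meet_iff L.meet_leI)
  qed
  have "h p \<in> carrier L" "h q \<in> carrier L" using Q[OF pq(1)] Q[OF pq(2)] lattice_homD(1)[OF h] by auto
  then have "\<not> (z \<sqsubseteq> h p \<and> h q \<sqsubseteq> x)" "\<not> (z \<sqsubseteq> h q \<and> h p \<sqsubseteq> x)" using xz pq(3) L.le_trans by metis+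
  then show ?thesis using Q[OF pq(1)] Q[OF pq(2)] by auto
qed

section \<open>Compact congruences of free lattices\<close>

lemma bottom_neq_top:
  fixes L (structure)
  assumes "bounded_lattice L" "x \<in> carrier L" "z \<in> carrier L" "\<not> z \<sqsubseteq> x"
  shows "\<bottom> \<noteq> \<top>"
proof
  interpret bounded_lattice L by fact
  assume "\<bottom> = \<top>"
  then have "z \<sqsubseteq> \<bottom>" using top_higher[OF assms(3)] by simp
  moreover have "\<bottom> \<sqsubseteq> x" using bottom_lower[OF assms(2)] .
  ultimately show False using assms le_trans bottom_closed by blast
qed

text \<open>Here \<open>\<beta> (i, m)\<close> is to be the generator number \<open>m\<close> owned by the index \<open>i\<close>. Each index needs the numbers
  \<open>0\<close> and \<open>1\<close>; the numbers \<open>2\<close> and \<open>3\<close> of a single index will span the interval in which everything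
  takes place.\<close>
lemma above_aleph1:
  assumes "cardSuc (cardSuc natLeq) \<le>o |G|"
  shows "cardSuc natLeq <o |G|" "infinite G"
    "\<exists>\<beta> :: 'a \<times> nat \<Rightarrow> 'a. inj_on \<beta> (G \<times> UNIV) \<and> \<beta> ` (G \<times> UNIV) \<subseteq> (G :: 'a set)"
proof -
  have c: "Card_order (cardSuc natLeq)" by (simp add: cardSuc_Card_order natLeq_Card_order)
  show 1: "cardSuc natLeq <o |G|" using ordLess_ordLeq_trans[OF cardSuc_greater[OF c] assms] .
  have "natLeq \<le>o |G|"
    using ordLeq_transitive[OF cardSuc_ordLeq[OF natLeq_Card_order] ordLess_imp_ordLeq[OF 1]] .
  then show inf: "infinite G" using infinite_iff_natLeq_ordLeq by blast
  have "|UNIV :: nat set| \<le>o |G|" using inf infinite_iff_card_of_nat by blast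
  then have "|G \<times> (UNIV :: nat set)| \<le>o |G|"
    using card_of_Times_infinite[OF inf] ordIso_iff_ordLeq by blast
  then show "\<exists>\<beta> :: 'a \<times> nat \<Rightarrow> 'a. inj_on \<beta> (G \<times> UNIV) \<and> \<beta> ` (G \<times> UNIV) \<subseteq> (G :: 'a set)"
    by (simp add: card_of_ordLeq)
qed

text \<open>Uniform refinement fails in the compact congruences of a free lattice. All comparisons of congruences
  are tested against kernels of homomorphisms to a single lattice \<open>L\<close>: a congruence given by generating
  pairs lies in a kernel iff the homomorphism identifies these pairs.\<close>
theorem no_V_distance:
  fixes N :: "'n gorder" and F :: "'f gorder"
  assumes N: "in_variety E N" "\<not> distributive N"
    and free: "free_lattice E F G \<or> free_bounded_lattice E F G"
    and large: "cardSuc (cardSuc natLeq) \<le>o |G|"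
    and V: "V_distance_three_halves (Conc (lattice_alg F)) X \<delta>"
    and gen: "range_join_generates (Conc (lattice_alg F)) X \<delta>"
  shows False
proof -
  obtain K0 K1 where F: "lattice F" and G: "G \<subseteq> carrier F" and K: "K0 \<subseteq> carrier F" "K1 \<subseteq> carrier F"
    and carrier_F: "carrier F = gen F (G \<union> (K0 \<union> K1))"
    and homs: "\<And>(L :: 'f gorder) g. \<lbrakk>in_variety E L; bounded_lattice L; g \<in> G \<rightarrow> carrier L\<rbrakk> \<Longrightarrow>
       \<exists>h. lattice_hom F L h \<and> (\<forall>x\<in>G. h x = g x) \<and> (\<forall>x\<in>K0. h x = \<bottom>\<^bsub>L\<^esub>) \<and> (\<forall>x\<in>K1. h x = \<top>\<^bsub>L\<^esub>)"
    using free_lattice_homs[OF free] by blast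
  interpret F: lattice F by (rule F)
  define A where "A = lattice_alg F"
  have A: "algebra A" unfolding A_def by (rule algebra_lattice_alg[OF F])
  have cA: "carrier A = carrier F" by (simp add: A_def lattice_alg_def)
  obtain \<beta> :: "'f \<times> nat \<Rightarrow> 'f" where \<beta>: "inj_on \<beta> (G \<times> UNIV)" "\<beta> ` (G \<times> UNIV) \<subseteq> G"
    using above_aleph1(3)[OF large] by blast
  have \<beta>_eq: "\<beta> (i, m) = \<beta> (j, n) \<longleftrightarrow> i = j \<and> m = n" if "i \<in> G" "j \<in> G" for i j m n
    using inj_on_eq_iff[OF \<beta>(1), of "(i, m)" "(j, n)"] that by auto
  have \<beta>G: "\<beta> (i, m) \<in> G" if "i \<in> G" for i m using \<beta>(2) that by blast
  then have \<beta>F: "\<beta> (i, m) \<in> carrier F" if "i \<in> G" for i m using G that by blast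
  obtain g0 where g0: "g0 \<in> G" using above_aleph1(2)[OF large] by fastforce
  define u w where "u = \<beta> (g0, 2)" and "w = \<beta> (g0, 3)"
  have uw: "u \<in> carrier F" "w \<in> carrier F" using \<beta>F g0 by (auto simp: u_def w_def)
  \<comment> \<open>Each element is clamped into the interval \<open>[lo, hi]\<close> that takes over the role of \<open>[0, 1]\<close>: this
    way the construction works without bounds in \<open>F\<close>, and a homomorphism that sends \<open>u\<close> and \<open>w\<close> to
    the bounds of a test lattice does not notice the clamping.\<close>
  define lo hi where "lo = u \<sqinter>\<^bsub>F\<^esub> w" and "hi = u \<squnion>\<^bsub>F\<^esub> w"
  define clamp where "clamp p = (p \<sqinter>\<^bsub>F\<^esub> hi) \<squnion>\<^bsub>F\<^esub> lo" for p
  define s t where "s i = clamp (\<beta> (i, 0))" and "t i = clamp (\<beta> (i, 0)) \<squnion>\<^bsub>F\<^esub> clamp (\<beta> (i, 1))" for i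
  have st: "lo \<in> carrier F" "hi \<in> carrier F" "\<And>i. i \<in> G \<Longrightarrow> s i \<in> carrier F" "\<And>i. i \<in> G \<Longrightarrow> t i \<in> carrier F"
    using uw \<beta>F by (simp_all add: lo_def hi_def s_def t_def clamp_def)
  define a b where "a i = Cg A {(lo, s i), (t i, hi)}" and "b i = Cg A {(s i, t i)}" for i
  define e where "e = Cg A {(lo, hi)}"
  have in_Conc: "Cg A R \<in> carrier (Conc A)" if "finite R" "R \<subseteq> carrier F \<times> carrier F" for R
    using that unfolding Conc_def cA by auto
  have ab: "a i \<in> carrier (Conc A) \<and> b i \<in> carrier (Conc A)" if "i \<in> G" for i
    unfolding a_def b_def using st that by (intro conjI in_Conc) auto
  have e: "e \<in> carrier (Conc A)" unfolding e_def using st by (intro in_Conc) auto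
  have Cg_sub: "Cg A R \<subseteq> \<theta> \<longleftrightarrow> R \<subseteq> \<theta>" if "congruence A \<theta>" "R \<subseteq> carrier F \<times> carrier F" for R \<theta>
    using Cg_le_iff[OF A _ that(1), of R] that(2) cA by simp
  have a_sub: "a i \<subseteq> \<theta> \<longleftrightarrow> (lo, s i) \<in> \<theta> \<and> (t i, hi) \<in> \<theta>"
    and b_sub: "b i \<subseteq> \<theta> \<longleftrightarrow> (s i, t i) \<in> \<theta>" if "congruence A \<theta>" "i \<in> G" for i \<theta>
    unfolding a_def b_def using Cg_sub[OF that(1)] st that(2) by simp_all
  have e_sub: "e \<subseteq> \<theta> \<longleftrightarrow> (lo, hi) \<in> \<theta>" if "congruence A \<theta>" for \<theta>
    unfolding e_def using Cg_sub[OF that] st by simp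
  interpret S: upper_semilattice "Conc A" by (rule Conc_semilattice(1)[OF A])
  have cover: "e \<sqsubseteq>\<^bsub>Conc A\<^esub> a i \<squnion>\<^bsub>Conc A\<^esub> b i" if i: "i \<in> G" for i
  proof -
    let ?\<theta> = "a i \<squnion>\<^bsub>Conc A\<^esub> b i"
    have \<theta>: "congruence A ?\<theta>" using ab[OF i] by (intro congruence_Conc[OF A]) simp
    have "a i \<subseteq> ?\<theta>" "b i \<subseteq> ?\<theta>" using Conc_join_subset_iff[OF A _ _ \<theta>] ab[OF i] by blast+
    then have "(lo, s i) \<in> ?\<theta>" "(s i, t i) \<in> ?\<theta>" "(t i, hi) \<in> ?\<theta>"
      using a_sub[OF \<theta> i] b_sub[OF \<theta> i] by blast+
    moreover have "trans ?\<theta>" using \<theta> by (simp add: congruence_def equiv_def)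
    ultimately have "(lo, hi) \<in> ?\<theta>" by (meson transD)
    then show ?thesis using e_sub[OF \<theta>] by simp
  qed
  obtain J c where J: "J \<subseteq> G" "cardSuc natLeq <o |J|"
    and c_all: "\<forall>i\<in>J. \<forall>j\<in>J. c i j \<in> carrier (Conc A) \<and> c i j \<sqsubseteq>\<^bsub>Conc A\<^esub> a i \<squnion>\<^bsub>Conc A\<^esub> a j \<and>
      c i j \<sqsubseteq>\<^bsub>Conc A\<^esub> b i \<squnion>\<^bsub>Conc A\<^esub> b j \<and> e \<sqsubseteq>\<^bsub>Conc A\<^esub> (a j \<squnion>\<^bsub>Conc A\<^esub> b i) \<squnion>\<^bsub>Conc A\<^esub> c i j"
    and c_tri_all: "\<forall>i\<in>J. \<forall>j\<in>J. \<forall>k\<in>J. c i k \<sqsubseteq>\<^bsub>Conc A\<^esub> c i j \<squnion>\<^bsub>Conc A\<^esub> c j k"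
    by (rule uniform_refinement[where I = G and a = a and b = b, OF Conc_semilattice[OF A]
        V[folded A_def] gen[folded A_def] e ab cover above_aleph1(1)[OF large]])
  have c: "c i j \<in> carrier (Conc A)"
    and c_a: "c i j \<sqsubseteq>\<^bsub>Conc A\<^esub> a i \<squnion>\<^bsub>Conc A\<^esub> a j" and c_b: "c i j \<sqsubseteq>\<^bsub>Conc A\<^esub> b i \<squnion>\<^bsub>Conc A\<^esub> b j"
    and c_e: "e \<sqsubseteq>\<^bsub>Conc A\<^esub> (a j \<squnion>\<^bsub>Conc A\<^esub> b i) \<squnion>\<^bsub>Conc A\<^esub> c i j" if "i \<in> J" "j \<in> J" for i j
    using c_all that by blast+
  have c_tri: "c i k \<sqsubseteq>\<^bsub>Conc A\<^esub> c i j \<squnion>\<^bsub>Conc A\<^esub> c j k" if "i \<in> J" "j \<in> J" "k \<in> J" for i j k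
    using c_tri_all that by blast
  \<comment> \<open>For each pair of indices, a finite generating set \<open>R\<close> of the refinement congruence and a finite
    set \<open>T\<close> of generators of \<open>F\<close> that suffice to write down \<open>R\<close>.\<close>
  define supp where "supp i j RT \<longleftrightarrow> finite (snd RT) \<and> snd RT \<subseteq> G \<union> (K0 \<union> K1) \<and>
      fst RT \<subseteq> gen F (snd RT) \<times> gen F (snd RT) \<and> c i j = Cg A (fst RT)" for i j RT
  have ex_supp: "\<exists>RT. supp i j RT" if ij: "i \<in> J" "j \<in> J" for i j
  proof -
    obtain R where R: "finite R" "R \<subseteq> carrier F \<times> carrier F" "c i j = Cg A R"
      using c[OF ij] unfolding Conc_def cA by auto
    have "finite (fst ` R \<union> snd ` R)" "fst ` R \<union> snd ` R \<subseteq> gen F (G \<union> (K0 \<union> K1))"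
      using R(1,2) carrier_F by auto
    then obtain T where T: "finite T" "T \<subseteq> G \<union> (K0 \<union> K1)" "fst ` R \<union> snd ` R \<subseteq> gen F T"
      using gen_finite_set_support by meson
    have "R \<subseteq> gen F T \<times> gen F T" using T(3) by force
    then show ?thesis using T R(3) by (intro exI[of _ "(R, T)"]) (simp add: supp_def)
  qed
  define R T where "R i j = fst (SOME RT. supp i j RT)" and "T i j = snd (SOME RT. supp i j RT)" for i j
  have fin_T: "finite (T i j)" and T: "T i j \<subseteq> G \<union> (K0 \<union> K1)"
    and R: "R i j \<subseteq> gen F (T i j) \<times> gen F (T i j)" and c_R: "c i j = Cg A (R i j)"
    if "i \<in> J" "j \<in> J" for i j
    using someI_ex[OF ex_supp[OF that]] by (simp_all add: supp_def R_def T_def)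
  define \<Phi> where "\<Phi> i j = {k \<in> G. \<beta> (k, 0) \<in> T i j \<or> \<beta> (k, 1) \<in> T i j}" for i j
  have "finite (\<Phi> i j)" if "i \<in> J" "j \<in> J" for i j
  proof -
    have "inj_on (\<lambda>k. \<beta> (k, m)) G" for m by (rule inj_onI) (simp add: \<beta>_eq)
    then have "finite ((\<lambda>k. \<beta> (k, m)) -` T i j \<inter> G)" for m
      by (rule finite_vimage_IntI[OF fin_T[OF that]])
    then have "finite (((\<lambda>k. \<beta> (k, 0)) -` T i j \<inter> G) \<union> ((\<lambda>k. \<beta> (k, 1)) -` T i j \<inter> G))" by blast
    then show ?thesis by (rule rev_finite_subset) (auto simp: \<Phi>_def)
  qed
  then obtain i j k where ijk: "i \<in> J" "j \<in> J" "k \<in> J"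
    and ne: "i \<noteq> j" "i \<noteq> k" "j \<noteq> k" and free3: "k \<notin> \<Phi> i j" "i \<notin> \<Phi> j k" "j \<notin> \<Phi> i k"
    using exists_free_triple[OF J(2), of \<Phi> thesis] by blast
  have ijkG: "i \<in> G" "j \<in> G" "k \<in> G" using ijk J(1) by auto

  have "infinite (UNIV :: 'f set)" using above_aleph1(2)[OF large] by (rule infinite_super[OF subset_UNIV])
  then obtain L :: "'f gorder" and x y z where L: "in_variety E L" "bounded_lattice L"
    and xyz: "x \<in> carrier L" "y \<in> carrier L" "z \<in> carrier L"
    and compl: "x \<sqinter>\<^bsub>L\<^esub> y = \<bottom>\<^bsub>L\<^esub>" "x \<squnion>\<^bsub>L\<^esub> y = \<top>\<^bsub>L\<^esub>" "z \<sqinter>\<^bsub>L\<^esub> y = \<bottom>\<^bsub>L\<^esub>" "z \<squnion>\<^bsub>L\<^esub> y = \<top>\<^bsub>L\<^esub>"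
    and zx: "\<not> z \<sqsubseteq>\<^bsub>L\<^esub> x"
    by (rule two_complements_lattice[where ?'f = 'f, OF N])
  interpret L: bounded_lattice L by (rule L(2))
  have bt: "\<bottom>\<^bsub>L\<^esub> \<noteq> \<top>\<^bsub>L\<^esub>" by (rule bottom_neq_top[OF L(2) xyz(1,3) zx])
  \<comment> \<open>The values are arranged such that \<open>[s i, t i]\<close>, \<open>[s j, t j]\<close> and \<open>[s k, t k]\<close> are sent to \<open>[\<bottom>, x]\<close>,
    \<open>[y, \<top>]\<close> and \<open>[\<bottom>, z]\<close>. With \<open>x\<close>, \<open>y\<close> and \<open>z\<close> as parameters, the same formula also yields the
    coordinates of the resulting homomorphism.\<close>
  define val where "val x y z g = (if g = w then \<top>\<^bsub>L\<^esub> else if g = \<beta> (i, 1) then x else if g = \<beta> (j, 0) then y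
      else if g = \<beta> (j, 1) then \<top>\<^bsub>L\<^esub> else if g = \<beta> (k, 1) then z else \<bottom>\<^bsub>L\<^esub>)" for x y z g
  define is_H where "is_H x y z h \<longleftrightarrow> lattice_hom F L h \<and> (\<forall>g\<in>G. h g = val x y z g) \<and>
      (\<forall>g\<in>K0. h g = \<bottom>\<^bsub>L\<^esub>) \<and> (\<forall>g\<in>K1. h g = \<top>\<^bsub>L\<^esub>)" for x y z h
  define H where "H x y z = (SOME h. is_H x y z h)" for x y z
  have is_H: "is_H x y z (H x y z)" if "x \<in> carrier L" "y \<in> carrier L" "z \<in> carrier L" for x y z
  proof -
    have "val x y z \<in> G \<rightarrow> carrier L" using that by (auto simp: val_def)
    from someI_ex[OF homs[OF L this]] show ?thesis by (simp add: H_def is_H_def)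
  qed
  have H: "lattice_hom F L (H x y z)" and HG: "\<And>g. g \<in> G \<Longrightarrow> H x y z g = val x y z g"
    and HK: "\<And>g. g \<in> K0 \<Longrightarrow> H x y z g = \<bottom>\<^bsub>L\<^esub>" "\<And>g. g \<in> K1 \<Longrightarrow> H x y z g = \<top>\<^bsub>L\<^esub>"
    if "x \<in> carrier L" "y \<in> carrier L" "z \<in> carrier L" for x y z
    using is_H[OF that] by (auto simp: is_H_def)
  have kills: "(lo, s i) \<in> hom_ker F (H x y z)" "(t i, hi) \<in> hom_ker F (H x y z) \<longleftrightarrow> x = \<top>\<^bsub>L\<^esub>"
      "(s i, t i) \<in> hom_ker F (H x y z) \<longleftrightarrow> x = \<bottom>\<^bsub>L\<^esub>"
      "(lo, s j) \<in> hom_ker F (H x y z) \<longleftrightarrow> y = \<bottom>\<^bsub>L\<^esub>" "(t j, hi) \<in> hom_ker F (H x y z)"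
      "(s j, t j) \<in> hom_ker F (H x y z) \<longleftrightarrow> y = \<top>\<^bsub>L\<^esub>"
      "(lo, s k) \<in> hom_ker F (H x y z)" "(t k, hi) \<in> hom_ker F (H x y z) \<longleftrightarrow> z = \<top>\<^bsub>L\<^esub>"
      "(s k, t k) \<in> hom_ker F (H x y z) \<longleftrightarrow> z = \<bottom>\<^bsub>L\<^esub>"
      "(lo, hi) \<notin> hom_ker F (H x y z)"
    if X: "x \<in> carrier L" "y \<in> carrier L" "z \<in> carrier L" for x y z
  proof -
    note h = lattice_homD[OF H[OF X]]
    have "H x y z u = \<bottom>\<^bsub>L\<^esub>" "H x y z w = \<top>\<^bsub>L\<^esub>"
      using HG[OF X] \<beta>G g0 ijkG by (simp_all add: val_def u_def w_def \<beta>_eq)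
    then have lohi: "H x y z lo = \<bottom>\<^bsub>L\<^esub>" "H x y z hi = \<top>\<^bsub>L\<^esub>"
      using uw by (simp_all add: h lo_def hi_def L.bounds_simps)
    have cl: "H x y z (clamp p) = H x y z p" "clamp p \<in> carrier F" if "p \<in> carrier F" for p
      using that st h(1)[OF that that] by (simp_all add: clamp_def h lohi L.bounds_simps)
    have S: "H x y z (s l) = val x y z (\<beta> (l, 0))"
      and T: "H x y z (t l) = val x y z (\<beta> (l, 0)) \<squnion>\<^bsub>L\<^esub> val x y z (\<beta> (l, 1))" if "l \<in> G" for l
      using HG[OF X \<beta>G[OF that]] cl \<beta>F[OF that] by (simp_all add: s_def t_def h)
    have vals: "H x y z (s i) = \<bottom>\<^bsub>L\<^esub>" "H x y z (t i) = x" "H x y z (s j) = y" "H x y z (t j) = \<top>\<^bsub>L\<^esub>"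
      "H x y z (s k) = \<bottom>\<^bsub>L\<^esub>" "H x y z (t k) = z"
      using X ijkG g0 ne by (simp_all add: S T val_def w_def \<beta>_eq L.bounds_simps)
    show "(lo, s i) \<in> hom_ker F (H x y z)" "(t i, hi) \<in> hom_ker F (H x y z) \<longleftrightarrow> x = \<top>\<^bsub>L\<^esub>"
      "(s i, t i) \<in> hom_ker F (H x y z) \<longleftrightarrow> x = \<bottom>\<^bsub>L\<^esub>"
      "(lo, s j) \<in> hom_ker F (H x y z) \<longleftrightarrow> y = \<bottom>\<^bsub>L\<^esub>" "(t j, hi) \<in> hom_ker F (H x y z)"
      "(s j, t j) \<in> hom_ker F (H x y z) \<longleftrightarrow> y = \<top>\<^bsub>L\<^esub>"
      "(lo, s k) \<in> hom_ker F (H x y z)" "(t k, hi) \<in> hom_ker F (H x y z) \<longleftrightarrow> z = \<top>\<^bsub>L\<^esub>"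
      "(s k, t k) \<in> hom_ker F (H x y z) \<longleftrightarrow> z = \<bottom>\<^bsub>L\<^esub>"
      "(lo, hi) \<notin> hom_ker F (H x y z)"
      using st ijkG bt by (auto simp: hom_ker_def vals lohi)
  qed
  have ker: "congruence A (hom_ker F (H x y z))" if "x \<in> carrier L" "y \<in> carrier L" "z \<in> carrier L" for x y z
    unfolding A_def by (rule congruence_hom_ker[OF F H[OF that]])
  have c_sub: "c m n \<subseteq> \<theta> \<longleftrightarrow> R m n \<subseteq> \<theta>" if "m \<in> J" "n \<in> J" "congruence A \<theta>" for m n \<theta>
  proof -
    have "gen F (T m n) \<subseteq> carrier F" using T[OF that(1,2)] carrier_F gen_mono by metis
    then show ?thesis using c_R[OF that(1,2)] Cg_sub[OF that(3)] R[OF that(1,2)] by blast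
  qed
  have via_a: "R m n \<subseteq> \<theta>" if "m \<in> J" "n \<in> J" "congruence A \<theta>" "a m \<subseteq> \<theta>" "a n \<subseteq> \<theta>" for m n \<theta>
    using c_a[OF that(1,2)] Conc_join_subset_iff[OF A _ _ that(3), of "a m" "a n"] ab J(1) that
      c_sub[OF that(1-3)] by auto
  have via_b: "R m n \<subseteq> \<theta>" if "m \<in> J" "n \<in> J" "congruence A \<theta>" "b m \<subseteq> \<theta>" "b n \<subseteq> \<theta>" for m n \<theta>
    using c_b[OF that(1,2)] Conc_join_subset_iff[OF A _ _ that(3), of "b m" "b n"] ab J(1) that
      c_sub[OF that(1-3)] by auto
  have TF: "T m n \<subseteq> carrier F" if "m \<in> J" "n \<in> J" for m n using T[OF that] G K by blast

  let ?o = "\<bottom>\<^bsub>L\<^esub>" and ?l = "\<top>\<^bsub>L\<^esub>"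
  define h where "h = H x y z"
  \<comment> \<open>The coordinates of \<open>h\<close> at \<open>x\<close>, \<open>y\<close> and \<open>z\<close>. The pair \<open>hx, hy\<close> determines \<open>h\<close> where the generators
    of \<open>k\<close> do not occur, and the pair \<open>hz, hy\<close> where those of \<open>i\<close> do not occur. Where those of \<open>j\<close> do
    not occur, \<open>hz\<close> is the cut between \<open>x\<close> and \<open>z\<close>.\<close>
  define hx where "hx = H ?l ?o ?o"
  define hy where "hy = H ?o ?l ?o"
  define hz where "hz = H ?o ?o ?l"
  have bc: "?o \<in> carrier L" "?l \<in> carrier L" by simp_all
  note kers = ker[OF xyz, folded h_def] ker[OF bc(2,1,1), folded hx_def] ker[OF bc(1,2,1), folded hy_def]
    ker[OF bc(1,1,2), folded hz_def]
  note hs = H[OF xyz, folded h_def] H[OF bc(2,1,1), folded hx_def] H[OF bc(1,2,1), folded hy_def]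
    H[OF bc(1,1,2), folded hz_def]
  note hGs = HG[OF xyz, folded h_def] HG[OF bc(2,1,1), folded hx_def] HG[OF bc(1,2,1), folded hy_def]
    HG[OF bc(1,1,2), folded hz_def]
  note hKs = HK[OF xyz, folded h_def] HK[OF bc(2,1,1), folded hx_def] HK[OF bc(1,2,1), folded hy_def]
    HK[OF bc(1,1,2), folded hz_def]
  have "a i \<subseteq> hom_ker F hx" "a j \<subseteq> hom_ker F hx"
    unfolding a_sub[OF kers(2) ijkG(1)] a_sub[OF kers(2) ijkG(2)]
    using kills[OF bc(2,1,1), folded hx_def] by simp_all
  from via_a[OF ijk(1,2) kers(2) this] have ij_x: "R i j \<subseteq> hom_ker F hx" .
  have "b i \<subseteq> hom_ker F hy" "b j \<subseteq> hom_ker F hy" and bk_y: "b k \<subseteq> hom_ker F hy"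
    unfolding b_sub[OF kers(3) ijkG(1)] b_sub[OF kers(3) ijkG(2)] b_sub[OF kers(3) ijkG(3)]
    using kills[OF bc(1,2,1), folded hy_def] by simp_all
  from via_b[OF ijk(1,2) kers(3) this(1,2)] via_b[OF ijk(2,3) kers(3) this(2) bk_y]
  have ij_y: "R i j \<subseteq> hom_ker F hy" and jk_y: "R j k \<subseteq> hom_ker F hy" .
  have ak_z: "a k \<subseteq> hom_ker F hz" and aj_z: "a j \<subseteq> hom_ker F hz" and bi_z: "b i \<subseteq> hom_ker F hz"
    unfolding a_sub[OF kers(4) ijkG(3)] a_sub[OF kers(4) ijkG(2)] b_sub[OF kers(4) ijkG(1)]
    using kills[OF bc(1,1,2), folded hz_def] by simp_all
  have jk_z: "R j k \<subseteq> hom_ker F hz" by (rule via_a[OF ijk(2,3) kers(4) aj_z ak_z])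
  have "(h g, hx g, hy g) \<in> {(?o, ?o, ?o), (x, ?l, ?o), (y, ?o, ?l), (?l, ?l, ?l)}" if g: "g \<in> T i j" for g
  proof -
    have ng: "g \<noteq> \<beta> (k, 1)" using g free3(1) ijkG by (auto simp: \<Phi>_def)
    consider "g \<in> G" | "g \<in> K0" | "g \<in> K1" using T[OF ijk(1,2)] g by blast
    then show ?thesis by cases (use ng in \<open>simp_all add: hGs hKs val_def\<close>)
  qed
  note det = complements_determine[OF F TF[OF ijk(1,2)] L(2) bt hs(1,2,3) xyz(1,2) compl(1,2) this]
  have "h p = h q" if "(p, q) \<in> R i j" for p q
    by (rule det) (use that R[OF ijk(1,2)] ij_x ij_y in \<open>auto simp: hom_ker_def\<close>)
  then have ij_h: "R i j \<subseteq> hom_ker F h" using ij_x by (auto simp: hom_ker_def)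
  have "(h g, hz g, hy g) \<in> {(?o, ?o, ?o), (z, ?l, ?o), (y, ?o, ?l), (?l, ?l, ?l)}" if g: "g \<in> T j k" for g
  proof -
    have ng: "g \<noteq> \<beta> (i, 1)" using g free3(2) ijkG by (auto simp: \<Phi>_def)
    consider "g \<in> G" | "g \<in> K0" | "g \<in> K1" using T[OF ijk(2,3)] g by blast
    then show ?thesis by cases (use ng in \<open>simp_all add: hGs hKs val_def\<close>)
  qed
  note det = complements_determine[OF F TF[OF ijk(2,3)] L(2) bt hs(1,4,3) xyz(3,2) compl(3,4) this]
  have "h p = h q" if "(p, q) \<in> R j k" for p q
    by (rule det) (use that R[OF ijk(2,3)] jk_z jk_y in \<open>auto simp: hom_ker_def\<close>)
  then have jk_h: "R j k \<subseteq> hom_ker F h" using jk_y by (auto simp: hom_ker_def)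
  have "c i k \<subseteq> hom_ker F h"
    using c_tri[OF ijk] Conc_join_subset_iff[OF A c[OF ijk(1,2)] c[OF ijk(2,3)] kers(1)]
      c_sub[OF ijk(1,2) kers(1)] c_sub[OF ijk(2,3) kers(1)] ij_h jk_h by auto
  then have ik_h: "R i k \<subseteq> hom_ker F h" using c_sub[OF ijk(1,3) kers(1)] by blast
  have "(hz g = ?o \<and> h g \<sqsubseteq>\<^bsub>L\<^esub> x) \<or> (hz g = ?l \<and> z \<sqsubseteq>\<^bsub>L\<^esub> h g)" if g: "g \<in> T i k" for g
  proof -
    have ng: "g \<noteq> \<beta> (j, 0)" "g \<noteq> \<beta> (j, 1)" using g free3(3) ijkG by (auto simp: \<Phi>_def)
    consider "g \<in> G" | "g \<in> K0" | "g \<in> K1" using T[OF ijk(1,3)] g by blast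
    then show ?thesis
      by cases (use ng in \<open>simp_all add: hGs hKs val_def L.bottom_lower[OF xyz(1)] L.top_higher[OF xyz(3)] xyz\<close>)
  qed
  note det = cut_determined[OF F TF[OF ijk(1,3)] L(2) hs(1,4) xyz(1,3) zx this]
  have "hz p = hz q" if "(p, q) \<in> R i k" for p q
    by (rule det) (use that R[OF ijk(1,3)] ik_h in \<open>auto simp: hom_ker_def\<close>)
  then have "R i k \<subseteq> hom_ker F hz" using ik_h by (auto simp: hom_ker_def)
  then have "c i k \<subseteq> hom_ker F hz" using c_sub[OF ijk(1,3) kers(4)] by blast
  moreover have "a k \<squnion>\<^bsub>Conc A\<^esub> b i \<in> carrier (Conc A)" "a k \<squnion>\<^bsub>Conc A\<^esub> b i \<subseteq> hom_ker F hz"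
    using Conc_join_subset_iff[OF A _ _ kers(4), of "a k" "b i"] ab ijkG ak_z bi_z by simp_all
  ultimately have "(a k \<squnion>\<^bsub>Conc A\<^esub> b i) \<squnion>\<^bsub>Conc A\<^esub> c i k \<subseteq> hom_ker F hz"
    using Conc_join_subset_iff[OF A _ c[OF ijk(1,3)] kers(4)] by blast
  then have "e \<subseteq> hom_ker F hz" using c_e[OF ijk(1,3)] by simp
  then show False using e_sub[OF kers(4)] kills(10)[OF bc(1,1,2), folded hz_def] by blast
qed

section \<open>Distances from almost permutable congruences\<close>

lemma congruence_directed_Union:
  assumes A: "algebra A" and ne: "\<C> \<noteq> {}" and cong: "\<And>\<theta>. \<theta> \<in> \<C> \<Longrightarrow> congruence A \<theta>"
    and dir: "\<And>\<theta> \<eta>. \<theta> \<in> \<C> \<Longrightarrow> \<eta> \<in> \<C> \<Longrightarrow> \<exists>\<zeta>\<in>\<C>. \<theta> \<subseteq> \<zeta> \<and> \<eta> \<subseteq> \<zeta>"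
  shows "congruence A (\<Union>\<C>)"
proof -
  have fin: "\<exists>\<zeta>\<in>\<C>. P \<subseteq> \<zeta>" if "finite P" "P \<subseteq> \<Union>\<C>" for P
    using that
  proof (induction P)
    case empty
    then show ?case using ne by blast
  next
    case (insert p P)
    then obtain \<theta> \<eta> where "\<theta> \<in> \<C>" "P \<subseteq> \<theta>" "\<eta> \<in> \<C>" "p \<in> \<eta>" by auto
    moreover from this obtain \<zeta> where "\<zeta> \<in> \<C>" "\<theta> \<subseteq> \<zeta>" "\<eta> \<subseteq> \<zeta>" using dir by meson
    ultimately show ?case by (intro bexI[of _ \<zeta>]) auto
  qed
  have eq: "equiv (carrier A) \<theta>" if "\<theta> \<in> \<C>" for \<theta> using cong[OF that] by (simp add: congruence_def)
  have "equiv (carrier A) (\<Union>\<C>)"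
  proof (rule equivI)
    show "\<Union>\<C> \<subseteq> carrier A \<times> carrier A" using eq unfolding equiv_def by blast
    obtain \<theta> where "\<theta> \<in> \<C>" using ne by blast
    then show "refl_on (carrier A) (\<Union>\<C>)" using eq[of \<theta>] unfolding equiv_def refl_on_def by blast
    show "sym (\<Union>\<C>)" using eq unfolding equiv_def sym_def by blast
    show "trans (\<Union>\<C>)"
    proof (rule transI)
      fix x y z assume "(x, y) \<in> \<Union>\<C>" "(y, z) \<in> \<Union>\<C>"
      then obtain \<zeta> where "\<zeta> \<in> \<C>" "(x, y) \<in> \<zeta>" "(y, z) \<in> \<zeta>" using fin[of "{(x, y), (y, z)}"] by auto
      then show "(x, z) \<in> \<Union>\<C>" using eq[of \<zeta>] unfolding equiv_def by (blast dest: transD)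
    qed
  qed
  moreover have "(f xs, f ys) \<in> \<Union>\<C>"
    if f: "(n, f) \<in> ops A" "length xs = n" and rel: "list_all2 (\<lambda>x y. (x, y) \<in> \<Union>\<C>) xs ys" for n f xs ys
  proof -
    have "set (zip xs ys) \<subseteq> \<Union>\<C>" using rel by (auto simp: list_all2_iff)
    then obtain \<zeta> where \<zeta>: "\<zeta> \<in> \<C>" "set (zip xs ys) \<subseteq> \<zeta>" using fin[of "set (zip xs ys)"] by auto
    then have "list_all2 (\<lambda>x y. (x, y) \<in> \<zeta>) xs ys" using rel by (auto simp: list_all2_iff)
    then have "(f xs, f ys) \<in> \<zeta>" using cong[OF \<zeta>(1)] f unfolding congruence_def by blast
    then show ?thesis using \<zeta>(1) by blast
  qed
  ultimately show ?thesis unfolding congruence_def by blast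
qed

lemma Cg_incl: "R \<subseteq> Cg A R"
  by (auto simp: Cg_def)

lemma Cg_mono: "P \<subseteq> R \<Longrightarrow> Cg A P \<subseteq> Cg A R"
  unfolding Cg_def by blast

lemma congruence_subset: "congruence A \<theta> \<Longrightarrow> \<theta> \<subseteq> carrier A \<times> carrier A"
  unfolding congruence_def equiv_def by blast

locale Con_iso =
  fixes A :: "'a univ_alg" and B :: "'b univ_alg" and \<phi>
  assumes A: "algebra A" and B: "algebra B"
    and bij: "bij_betw \<phi> {\<theta>. congruence A \<theta>} {\<theta>. congruence B \<theta>}"
    and emb: "\<And>\<theta> \<eta>. congruence A \<theta> \<Longrightarrow> congruence A \<eta> \<Longrightarrow> \<phi> \<theta> \<subseteq> \<phi> \<eta> \<longleftrightarrow> \<theta> \<subseteq> \<eta>"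
begin

lemma \<phi>_cong: "congruence A \<theta> \<Longrightarrow> congruence B (\<phi> \<theta>)"
  using bij by (auto simp: bij_betw_def)

definition "\<psi> = inv_into {\<theta>. congruence A \<theta>} \<phi>"

lemma \<psi>: "congruence B \<eta> \<Longrightarrow> congruence A (\<psi> \<eta>)" "congruence B \<eta> \<Longrightarrow> \<phi> (\<psi> \<eta>) = \<eta>"
  using bij bij_betw_inv_into_right[OF bij, of \<eta>] inv_into_into[of \<eta> \<phi> "{\<theta>. congruence A \<theta>}"]
  by (auto simp: \<psi>_def bij_betw_def)

lemma \<psi>\<phi>: "congruence A \<theta> \<Longrightarrow> \<psi> (\<phi> \<theta>) = \<theta>"
  using bij_betw_inv_into_left[OF bij, of \<theta>] by (simp add: \<psi>_def)

lemma \<psi>_emb: "congruence B \<theta> \<Longrightarrow> congruence B \<eta> \<Longrightarrow> \<psi> \<theta> \<subseteq> \<psi> \<eta> \<longleftrightarrow> \<theta> \<subseteq> \<eta>"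
  using emb[OF \<psi>(1) \<psi>(1)] by (simp add: \<psi>(2))

lemma inverse_iso: "Con_iso B A \<psi>"
proof
  show "bij_betw \<psi> {\<theta>. congruence B \<theta>} {\<theta>. congruence A \<theta>}"
    unfolding \<psi>_def by (rule bij_betw_inv_into[OF bij])
qed (simp_all add: A B \<psi>_emb)

text \<open>Isomorphisms preserve compactness, and the compact congruences are the finitely generated ones.
  The preimage \<open>\<alpha>\<close> of \<open>Cg B P\<close> is the directed union of its finitely generated subcongruences. Their
  images in \<open>B\<close> have a directed union that is again a congruence, hence contains \<open>P\<close>; the finite set
  \<open>P\<close> is then contained in a single image, and \<open>\<alpha>\<close> is the corresponding subcongruence.\<close>
lemma \<psi>_compact:
  assumes P: "finite P" "P \<subseteq> carrier B \<times> carrier B"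
  shows "\<psi> (Cg B P) \<in> carrier (Conc A)"
proof -
  define \<alpha> where "\<alpha> = \<psi> (Cg B P)"
  have CB: "congruence B (Cg B P)" by (rule congruence_Cg[OF B P(2)])
  then have \<alpha>: "congruence A \<alpha>" unfolding \<alpha>_def by (rule \<psi>(1))
  define \<R> where "\<R> = {R. finite R \<and> R \<subseteq> \<alpha>}"
  have R: "congruence A (Cg A R)" "Cg A R \<subseteq> \<alpha>" "R \<subseteq> carrier A \<times> carrier A" if "R \<in> \<R>" for R
    using that congruence_subset[OF \<alpha>] congruence_Cg[OF A, of R] Cg_le_iff[OF A _ \<alpha>, of R] by (auto simp: \<R>_def)
  let ?\<C> = "(\<lambda>R. \<phi> (Cg A R)) ` \<R>"
  have U: "congruence B (\<Union>?\<C>)"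
  proof (rule congruence_directed_Union[OF B])
    have "{} \<in> \<R>" by (simp add: \<R>_def)
    then show "?\<C> \<noteq> {}" by blast
    show "congruence B \<theta>" if "\<theta> \<in> ?\<C>" for \<theta> using that R \<phi>_cong by auto
    fix \<theta> \<eta> assume "\<theta> \<in> ?\<C>" "\<eta> \<in> ?\<C>"
    then obtain R R' where RR: "R \<in> \<R>" "R' \<in> \<R>" "\<theta> = \<phi> (Cg A R)" "\<eta> = \<phi> (Cg A R')" by blast
    then have "R \<union> R' \<in> \<R>" by (simp add: \<R>_def)
    moreover from this have "\<theta> \<subseteq> \<phi> (Cg A (R \<union> R'))" "\<eta> \<subseteq> \<phi> (Cg A (R \<union> R'))"
      using RR R emb by (auto simp: Cg_mono)
    ultimately show "\<exists>\<zeta>\<in>?\<C>. \<theta> \<subseteq> \<zeta> \<and> \<eta> \<subseteq> \<zeta>" by blast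
  qed
  have "\<alpha> \<subseteq> \<psi> (\<Union>?\<C>)"
  proof
    fix p assume "p \<in> \<alpha>"
    then have "{p} \<in> \<R>" by (simp add: \<R>_def)
    then have "\<phi> (Cg A {p}) \<subseteq> \<Union>?\<C>" by blast
    then have "Cg A {p} \<subseteq> \<psi> (\<Union>?\<C>)"
      using \<psi>_emb[OF \<phi>_cong[OF R(1)[OF \<open>{p} \<in> \<R>\<close>]] U] by (simp add: \<psi>\<phi>[OF R(1)[OF \<open>{p} \<in> \<R>\<close>]])
    then show "p \<in> \<psi> (\<Union>?\<C>)" using Cg_incl by fast
  qed
  then have "Cg B P \<subseteq> \<Union>?\<C>" using \<psi>_emb[OF CB U] by (simp add: \<alpha>_def)
  then have "P \<subseteq> \<Union>?\<C>" using Cg_incl by blast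
  have "\<exists>R\<in>\<R>. Q \<subseteq> \<phi> (Cg A R)" if "finite Q" "Q \<subseteq> \<Union>?\<C>" for Q
    using that
  proof (induction Q)
    case empty
    have "{} \<in> \<R>" by (simp add: \<R>_def)
    then show ?case by blast
  next
    case (insert q Q)
    then obtain R R' where RR: "R \<in> \<R>" "R' \<in> \<R>" "Q \<subseteq> \<phi> (Cg A R)" "q \<in> \<phi> (Cg A R')" by auto
    then have RR': "R \<union> R' \<in> \<R>" by (simp add: \<R>_def)
    then have "\<phi> (Cg A R) \<subseteq> \<phi> (Cg A (R \<union> R'))" "\<phi> (Cg A R') \<subseteq> \<phi> (Cg A (R \<union> R'))"
      using RR R emb by (auto simp: Cg_mono)
    then show ?case using RR RR' by (intro bexI[of _ "R \<union> R'"]) auto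
  qed
  then obtain R where R0: "R \<in> \<R>" "P \<subseteq> \<phi> (Cg A R)" using P(1) \<open>P \<subseteq> \<Union>?\<C>\<close> by blast
  have "Cg B P \<subseteq> \<phi> (Cg A R)" using Cg_le_iff[OF B P(2) \<phi>_cong[OF R(1)[OF R0(1)]]] R0(2) by blast
  then have "\<alpha> \<subseteq> Cg A R"
    using \<psi>_emb[OF CB \<phi>_cong[OF R(1)[OF R0(1)]]] by (simp add: \<alpha>_def \<psi>\<phi>[OF R(1)[OF R0(1)]])
  then have "\<alpha> = Cg A R" using R(2)[OF R0(1)] by blast
  then show ?thesis using R0(1) R(3)[OF R0(1)] unfolding \<alpha>_def Conc_def \<R>_def by auto
qed

end

context Con_iso
begin

definition dist :: "'b \<Rightarrow> 'b \<Rightarrow> ('a \<times> 'a) set" where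
  "dist x y = \<psi> (Cg B {(x, y)})"

lemma dist_in_Conc: "x \<in> carrier B \<Longrightarrow> y \<in> carrier B \<Longrightarrow> dist x y \<in> carrier (Conc A)"
  unfolding dist_def by (rule \<psi>_compact) auto

lemma dist_subset_iff:
  assumes "congruence A \<theta>" "x \<in> carrier B" "y \<in> carrier B"
  shows "dist x y \<subseteq> \<theta> \<longleftrightarrow> (x, y) \<in> \<phi> \<theta>"
proof -
  have P: "{(x, y)} \<subseteq> carrier B \<times> carrier B" using assms by auto
  have "dist x y \<subseteq> \<theta> \<longleftrightarrow> Cg B {(x, y)} \<subseteq> \<phi> \<theta>"
    using \<psi>_emb[OF congruence_Cg[OF B P] \<phi>_cong[OF assms(1)]] by (simp add: dist_def \<psi>\<phi>[OF assms(1)])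
  then show ?thesis using Cg_le_iff[OF B P \<phi>_cong[OF assms(1)]] by simp
qed

lemma congruenceD:
  assumes "congruence B \<theta>"
  shows "x \<in> carrier B \<Longrightarrow> (x, x) \<in> \<theta>" "(x, y) \<in> \<theta> \<Longrightarrow> (y, x) \<in> \<theta>"
    "(x, y) \<in> \<theta> \<Longrightarrow> (y, z) \<in> \<theta> \<Longrightarrow> (x, z) \<in> \<theta>" "(x, y) \<in> \<theta> \<Longrightarrow> x \<in> carrier B \<and> y \<in> carrier B"
  using assms congruence_subset[OF assms] unfolding congruence_def equiv_def refl_on_def
  by (auto dest: symD transD)

lemma congruence_dist: "x \<in> carrier B \<Longrightarrow> y \<in> carrier B \<Longrightarrow> congruence A (dist x y)"
  using dist_in_Conc congruence_Conc[OF A] by blast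

lemma dist_distance: "S_valued_distance (Conc A) (carrier B) dist"
proof -
  interpret S: upper_semilattice "Conc A" by (rule Conc_semilattice(1)[OF A])
  have "dist x x = \<bottom>\<^bsub>Conc A\<^esub>" if x: "x \<in> carrier B" for x
  proof -
    have "least (Conc A) (dist x x) (carrier (Conc A))"
      unfolding least_def
      using dist_in_Conc[OF x x] dist_subset_iff[OF congruence_Conc[OF A] x x]
        congruenceD(1)[OF \<phi>_cong[OF congruence_Conc[OF A]] x]
      by (auto simp: subset_iff[of _ "carrier (Conc A)"])
    moreover have "least (Conc A) \<bottom>\<^bsub>Conc A\<^esub> (carrier (Conc A))"
      by (rule weak_partial_order_bottom.bottom_least[OF Conc_semilattice(2)[OF A]])
    ultimately show ?thesis by (rule S.least_unique)
  qed
  moreover have "dist x y = dist y x" if x: "x \<in> carrier B" and y: "y \<in> carrier B" for x y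
  proof -
    have "dist x y \<subseteq> dist y x" if x: "x \<in> carrier B" and y: "y \<in> carrier B" for x y
    proof -
      have "(y, x) \<in> \<phi> (dist y x)" using dist_subset_iff[OF congruence_dist[OF y x] y x] by blast
      then show ?thesis
        using dist_subset_iff[OF congruence_dist[OF y x] x y] congruenceD(2)[OF \<phi>_cong[OF congruence_dist[OF y x]]]
        by blast
    qed
    then show ?thesis using x y by blast
  qed
  moreover have "dist x z \<subseteq> dist x y \<squnion>\<^bsub>Conc A\<^esub> dist y z"
    if x: "x \<in> carrier B" and y: "y \<in> carrier B" and z: "z \<in> carrier B" for x y z
  proof -
    let ?\<theta> = "dist x y \<squnion>\<^bsub>Conc A\<^esub> dist y z"
    have \<theta>: "congruence A ?\<theta>" using dist_in_Conc x y z by (intro congruence_Conc[OF A] S.join_closed) auto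
    have "dist x y \<subseteq> ?\<theta>" "dist y z \<subseteq> ?\<theta>"
      using Conc_join_subset_iff[OF A dist_in_Conc[OF x y] dist_in_Conc[OF y z] \<theta>] by blast+
    then have "(x, y) \<in> \<phi> ?\<theta>" "(y, z) \<in> \<phi> ?\<theta>"
      using dist_subset_iff[OF \<theta> x y] dist_subset_iff[OF \<theta> y z] by blast+
    then show ?thesis using dist_subset_iff[OF \<theta> x z] congruenceD(3)[OF \<phi>_cong[OF \<theta>]] by blast
  qed
  ultimately show ?thesis using dist_in_Conc unfolding S_valued_distance_def by simp
qed

lemma congruence_Con_join:
  assumes \<alpha>: "congruence B \<alpha>" and \<beta>: "congruence B \<beta>"
  shows "congruence B (\<alpha> \<squnion>\<^bsub>Con B\<^esub> \<beta>)"
proof -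
  have sub: "\<alpha> \<union> \<beta> \<subseteq> carrier B \<times> carrier B" using congruence_subset \<alpha> \<beta> by blast
  have "congruence B (Cg B (\<alpha> \<union> \<beta>))" by (rule congruence_Cg[OF B sub])
  moreover have "\<alpha> \<union> \<beta> \<subseteq> Cg B (\<alpha> \<union> \<beta>)" by (rule Cg_incl)
  moreover have "Cg B (\<alpha> \<union> \<beta>) \<subseteq> \<theta>" if "congruence B \<theta>" "\<alpha> \<subseteq> \<theta>" "\<beta> \<subseteq> \<theta>" for \<theta>
    using Cg_le_iff[OF B sub that(1)] that by blast
  ultimately have "least (Con B) (Cg B (\<alpha> \<union> \<beta>)) (Upper (Con B) {\<alpha>, \<beta>})"
    using \<alpha> \<beta> by (intro least_UpperI) (auto simp: Con_def Upper_def)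
  then have "least (Con B) (\<alpha> \<squnion>\<^bsub>Con B\<^esub> \<beta>) (Upper (Con B) {\<alpha>, \<beta>})"
    unfolding join_def sup_def by (rule someI)
  then have "\<alpha> \<squnion>\<^bsub>Con B\<^esub> \<beta> \<in> carrier (Con B)" by (rule least_closed) 
  then show ?thesis by (simp add: Con_def)
qed

text \<open>The intermediate point is the one that witnesses the composition of relations. The join in the
  compact congruences of \<open>A\<close> need only be compared with the join in the congruences of \<open>B\<close>, since
  \<open>\<psi>\<close> sends the latter to an upper bound of \<open>a\<close> and \<open>b\<close>.\<close>
lemma dist_three_halves:
  assumes ap: "almost_permutable_congruences B"
  shows "V_distance_three_halves (Conc A) (carrier B) dist"
proof -
  have "\<exists>z\<in>carrier B. (dist x z \<subseteq> a \<and> dist z y \<subseteq> b) \<or> (dist x z \<subseteq> b \<and> dist z y \<subseteq> a)"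
    if x: "x \<in> carrier B" and y: "y \<in> carrier B" and a: "a \<in> carrier (Conc A)" and b: "b \<in> carrier (Conc A)"
      and le: "dist x y \<subseteq> a \<squnion>\<^bsub>Conc A\<^esub> b" for x y a b
  proof -
    have ca: "congruence A a" and cb: "congruence A b" using congruence_Conc[OF A] a b by auto
    let ?\<kappa> = "\<phi> a \<squnion>\<^bsub>Con B\<^esub> \<phi> b"
    have \<kappa>: "?\<kappa> = (\<phi> a O \<phi> b) \<union> (\<phi> b O \<phi> a)"
      using ap \<phi>_cong[OF ca] \<phi>_cong[OF cb] unfolding almost_permutable_congruences_def Con_def by simp
    have c\<kappa>: "congruence B ?\<kappa>" by (rule congruence_Con_join[OF \<phi>_cong[OF ca] \<phi>_cong[OF cb]])
    note Ca = congruenceD[OF \<phi>_cong[OF ca]] and Cb = congruenceD[OF \<phi>_cong[OF cb]]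
    have "\<phi> a \<subseteq> ?\<kappa>"
    proof
      fix p assume "p \<in> \<phi> a"
      then obtain u v where "p = (u, v)" "(u, v) \<in> \<phi> a" "(v, v) \<in> \<phi> b" using Ca(4) Cb(1) by (metis surj_pair)
      then show "p \<in> ?\<kappa>" unfolding \<kappa> by blast
    qed
    moreover have "\<phi> b \<subseteq> ?\<kappa>"
    proof
      fix p assume "p \<in> \<phi> b"
      then obtain u v where "p = (u, v)" "(u, v) \<in> \<phi> b" "(v, v) \<in> \<phi> a" using Cb(4) Ca(1) by (metis surj_pair)
      then show "p \<in> ?\<kappa>" unfolding \<kappa> by blast
    qed
    ultimately have "a \<subseteq> \<psi> ?\<kappa>" "b \<subseteq> \<psi> ?\<kappa>"
      using \<psi>_emb[OF \<phi>_cong[OF ca] c\<kappa>] \<psi>_emb[OF \<phi>_cong[OF cb] c\<kappa>] by (simp_all add: \<psi>\<phi> ca cb)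
    then have "dist x y \<subseteq> \<psi> ?\<kappa>" using le Conc_join_subset_iff[OF A a b \<psi>(1)[OF c\<kappa>]] by blast
    then have "(x, y) \<in> ?\<kappa>" using dist_subset_iff[OF \<psi>(1)[OF c\<kappa>] x y] by (simp add: \<psi>(2)[OF c\<kappa>])
    then obtain z where z: "((x, z) \<in> \<phi> a \<and> (z, y) \<in> \<phi> b) \<or> ((x, z) \<in> \<phi> b \<and> (z, y) \<in> \<phi> a)"
      unfolding \<kappa> by blast
    then have zB: "z \<in> carrier B" using Ca(4) Cb(4) by blast
    show ?thesis
      using z dist_subset_iff[OF ca x zB] dist_subset_iff[OF cb x zB] dist_subset_iff[OF ca zB y]
        dist_subset_iff[OF cb zB y] zB by blast
  qed
  then show ?thesis using dist_distance unfolding V_distance_three_halves_def by simp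
qed

lemma dist_range_join_generates: "range_join_generates (Conc A) (carrier B) dist"
proof -
  interpret S: upper_semilattice "Conc A" by (rule Conc_semilattice(1)[OF A])
  interpret inv: Con_iso B A \<psi> by (rule inverse_iso)
  have "\<exists>D. finite D \<and> D \<subseteq> {dist x y |x y. x \<in> carrier B \<and> y \<in> carrier B} \<and> s = \<Squnion>\<^bsub>Conc A\<^esub>D"
    if s: "s \<in> carrier (Conc A)" for s
  proof -
    have cs: "congruence A s" by (rule congruence_Conc[OF A s])
    obtain R where R: "finite R" "R \<subseteq> carrier A \<times> carrier A" "s = Cg A R" using s unfolding Conc_def by auto
    have "inv.\<psi> s = \<phi> s" using inv.\<psi>\<phi>[OF \<phi>_cong[OF cs]] by (simp add: \<psi>\<phi>[OF cs])
    then have "\<phi> s \<in> carrier (Conc B)" using inv.\<psi>_compact[OF R(1,2)] R(3) by simp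
    then obtain P where P: "finite P" "P \<subseteq> carrier B \<times> carrier B" "\<phi> s = Cg B P" unfolding Conc_def by auto
    let ?D = "(\<lambda>(x, y). dist x y) ` P"
    have D: "finite ?D" "?D \<subseteq> {dist x y |x y. x \<in> carrier B \<and> y \<in> carrier B}" using P by auto
    then have DC: "?D \<subseteq> carrier (Conc A)" using dist_in_Conc by auto
    have below: "(\<forall>d\<in>?D. d \<subseteq> \<eta>) \<longleftrightarrow> s \<subseteq> \<eta>" if \<eta>: "congruence A \<eta>" for \<eta>
    proof -
      have "(\<forall>d\<in>?D. d \<subseteq> \<eta>) \<longleftrightarrow> P \<subseteq> \<phi> \<eta>" using dist_subset_iff[OF \<eta>] P(2) by fastforce
      also have "\<dots> \<longleftrightarrow> \<phi> s \<subseteq> \<phi> \<eta>" using Cg_le_iff[OF B P(2) \<phi>_cong[OF \<eta>]] P(3) by simp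
      also have "\<dots> \<longleftrightarrow> s \<subseteq> \<eta>" by (rule emb[OF cs \<eta>])
      finally show ?thesis .
    qed
    have "least (Conc A) s (Upper (Conc A) ?D)"
    proof (rule least_UpperI)
      show "d \<sqsubseteq>\<^bsub>Conc A\<^esub> s" if "d \<in> ?D" for d
        unfolding le_Conc by (rule bspec[OF iffD2[OF below[OF cs] subset_refl] that])
      show "s \<sqsubseteq>\<^bsub>Conc A\<^esub> \<eta>" if "\<eta> \<in> Upper (Conc A) ?D" for \<eta>
      proof -
        have \<eta>: "\<eta> \<in> carrier (Conc A)" "\<forall>d\<in>?D. d \<subseteq> \<eta>"
          using that DC by (auto simp: Upper_def)
        show ?thesis unfolding le_Conc by (rule iffD1[OF below[OF congruence_Conc[OF A \<eta>(1)]] \<eta>(2)])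
      qed
    qed (use DC s in auto)
    then have "s = \<Squnion>\<^bsub>Conc A\<^esub>?D"
      using S.least_unique least_finite_sup[OF Conc_semilattice[OF A] D(1) DC] by blast
    then show ?thesis using D by blast
  qed
  then show ?thesis unfolding range_join_generates_def by blast
qed

end

theorem corollary3p8:
  fixes E :: "(lat_term \<times> lat_term) set"
    and N :: "'n gorder"
    and F :: "'f gorder"
    and G :: "'f set"
  assumes "in_variety E N" and "\<not> distributive N"
    and "free_lattice E F G \<or> free_bounded_lattice E F G"
    and "(cardSuc (cardSuc natLeq), card_of G) \<in> ordLeq"
  shows "(\<nexists>(X :: 'x set) \<delta>. V_distance_three_halves (Conc (lattice_alg F)) X \<delta> \<and>
             range_join_generates (Conc (lattice_alg F)) X \<delta>) \<and>
         (\<nexists>A :: 'a univ_alg. algebra A \<and> almost_permutable_congruences A \<and>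
             order_isomorphic (Con (lattice_alg F)) (Con A))"
proof (intro conjI notI; elim exE conjE)
  fix X :: "'x set" and \<delta>
  assume "V_distance_three_halves (Conc (lattice_alg F)) X \<delta>" "range_join_generates (Conc (lattice_alg F)) X \<delta>"
  then show False by (rule no_V_distance[OF assms])
next
  fix A :: "'a univ_alg"
  assume alg: "algebra A" "almost_permutable_congruences A" "order_isomorphic (Con (lattice_alg F)) (Con A)"
  have "lattice F" using assms(3) by (auto simp: free_lattice_def free_bounded_lattice_def in_variety_def)
  obtain \<phi> where \<phi>: "bij_betw \<phi> (carrier (Con (lattice_alg F))) (carrier (Con A))"
    "order_emb (Con (lattice_alg F)) (Con A) \<phi>"
    using alg(3) unfolding order_isomorphic_def by blast
  interpret Con_iso "lattice_alg F" A \<phi>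
    by unfold_locales
      (use algebra_lattice_alg[OF \<open>lattice F\<close>] alg(1) \<phi> in \<open>auto simp: Con_def order_emb_def\<close>)
  show False
    by (rule no_V_distance[OF assms dist_three_halves[OF alg(2)] dist_range_join_generates])
qed

end
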